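(* Let $M$ be an $n\times n$ Haar-distributed random orthogonal matrix and $P$ an $n\times n$ permutation matrix chosen uniformly at random from the $n!$ permutation matrices, independent of $M$. For fixed indices $a,b$, \[\sqrt{n}(MPM^T)_{ab}\xrightarrow{d}\mathcal{N}(0,1)\quad\text{as } n\to\infty.\]
   Context: Haar measure on $O(n)$ is the unique left- and right-invariant probability measure. *)

theory Defs
  imports "HOL-Probability.Probability"
begin

text \<open>n x n real matrices are represented as functions nat => nat => real,
  indexed by 0..n-1 and extended by zero outside this range.\<close>

definition mat_mult :: "nat \<Rightarrow> (nat \<Rightarrow> nat \<Rightarrow> real) \<Rightarrow> (nat \<Rightarrow> nat \<Rightarrow> real) \<Rightarrow> (nat \<Rightarrow> nat \<Rightarrow> real)" where
  "mat_mult n A B = (\<lambda>i j. if i < n \<and> j < n then (\<Sum>k<n. A i k * B k j) else 0)"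

definition mat_transpose :: "nat \<Rightarrow> (nat \<Rightarrow> nat \<Rightarrow> real) \<Rightarrow> (nat \<Rightarrow> nat \<Rightarrow> real)" where
  "mat_transpose n A = (\<lambda>i j. if i < n \<and> j < n then A j i else 0)"

definition id_mat :: "nat \<Rightarrow> (nat \<Rightarrow> nat \<Rightarrow> real)" where
  "id_mat n = (\<lambda>i j. if i < n \<and> j < n \<and> i = j then 1 else 0)"

definition orth_mats :: "nat \<Rightarrow> (nat \<Rightarrow> nat \<Rightarrow> real) set" where
  "orth_mats n = {M. (\<forall>i j. (n \<le> i \<or> n \<le> j) \<longrightarrow> M i j = 0)
                    \<and> mat_mult n M (mat_transpose n M) = id_mat n}"

definition haar_orth :: "nat \<Rightarrow> (nat \<Rightarrow> nat \<Rightarrow> real) measure \<Rightarrow> bool" where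
  "haar_orth n \<mu> \<longleftrightarrow> prob_space \<mu>
     \<and> sets \<mu> = sets (restrict_space borel (orth_mats n))
     \<and> (\<forall>Q \<in> orth_mats n. distr \<mu> \<mu> (\<lambda>M. mat_mult n Q M) = \<mu>
                          \<and> distr \<mu> \<mu> (\<lambda>M. mat_mult n M Q) = \<mu>)"

definition perm_mat :: "nat \<Rightarrow> (nat \<Rightarrow> nat) \<Rightarrow> (nat \<Rightarrow> nat \<Rightarrow> real)" where
  "perm_mat n \<sigma> = (\<lambda>i j. if i < n \<and> j < n \<and> \<sigma> i = j then 1 else 0)"

definition unif_perm :: "nat \<Rightarrow> (nat \<Rightarrow> nat) pmf" where
  "unif_perm n = pmf_of_set {\<sigma>. \<sigma> permutes {..<n}}"

end

theory Submission
  imports Defs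
begin

text \<open>
  Put \<open>A = M P M\<^sup>T\<close>. Left invariance of Haar measure under the rotation by \<open>\<theta>\<close> of rows \<open>a\<close> and \<open>j\<close>,
  differentiated at \<open>\<theta> = 0\<close> and summed over \<open>j\<close>, gives for smooth \<open>g\<close> and fixed \<open>P\<close> the Stein identities
  \<open>n E[A\<^sub>a\<^sub>a g(A\<^sub>a\<^sub>a)] = E[tr P g(A\<^sub>a\<^sub>a)] + E[(1 + (A\<^sup>2)\<^sub>a\<^sub>a - 2 A\<^sub>a\<^sub>a\<^sup>2) g'(A\<^sub>a\<^sub>a)]\<close> and, for \<open>a \<noteq> b\<close>,
  \<open>(n - 2) E[A\<^sub>a\<^sub>b g(A\<^sub>a\<^sub>b)] = E[(1 - A\<^sub>a\<^sub>b\<^sup>2 - A\<^sub>b\<^sub>b\<^sup>2) g'(A\<^sub>a\<^sub>b)]\<close>.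
  The choice \<open>g(x) = x\<close> bounds the second moments by \<open>O((tr P + 1) / n)\<close>, also for \<open>A\<^sup>2 = M P\<^sup>2 M\<^sup>T\<close>, so the
  correction terms are negligible. The choice \<open>g(x) = exp (i t \<surd>n x)\<close> then shows that the characteristic
  function \<open>\<phi>\<close> of \<open>\<surd>n A\<^sub>a\<^sub>b\<close> nearly solves \<open>\<phi>' = - t \<phi>\<close>, the error being \<open>O((tr P + tr P\<^sup>2 + 1) / \<surd>n)\<close>.
  A uniform permutation has boundedly many fixed points and 2-cycles on average, so averaging over \<open>P\<close>
  and Levy's continuity theorem conclude.
\<close>

section \<open>Vector derivatives and differentiation under the integral sign\<close>

lemma has_vector_derivative_iff_quotient:
  fixes f :: "real \<Rightarrow> 'b::real_normed_vector"
  shows "(f has_vector_derivative f') (at x) \<longleftrightarrow>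
    ((\<lambda>y. (f y - f x) /\<^sub>R (y - x)) \<longlongrightarrow> f') (at x)"
proof -
  have eq: "norm ((f y - f x) /\<^sub>R (y - x) - f') = norm (f y - f x - (y - x) *\<^sub>R f') / norm (y - x)"
    if "y \<noteq> x" for y
  proof -
    have "(f y - f x) /\<^sub>R (y - x) - f' = (f y - f x - (y - x) *\<^sub>R f') /\<^sub>R (y - x)"
      using that by (simp add: scaleR_diff_right)
    then show ?thesis
      by (simp add: divide_inverse mult.commute)
  qed
  have "((\<lambda>y. (f y - f x) /\<^sub>R (y - x)) \<longlongrightarrow> f') (at x) \<longleftrightarrow>
    ((\<lambda>y. norm ((f y - f x) /\<^sub>R (y - x) - f')) \<longlongrightarrow> 0) (at x)"
    by (simp add: tendsto_norm_zero_iff LIM_zero_iff)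
  also have "\<dots> \<longleftrightarrow> ((\<lambda>y. norm (f y - f x - (y - x) *\<^sub>R f') / norm (y - x)) \<longlongrightarrow> 0) (at x)"
    by (intro tendsto_cong) (auto simp: eventually_at_filter eq)
  also have "\<dots> \<longleftrightarrow> (f has_vector_derivative f') (at x)"
    by (simp add: has_vector_derivative_def has_derivative_iff_norm bounded_linear_scaleR_left)
  finally show ?thesis by simp
qed

lemma norm_diff_le_of_vector_derivative:
  fixes f :: "real \<Rightarrow> 'b::real_normed_vector"
  assumes "\<And>x. (f has_vector_derivative f' x) (at x)" "\<And>x. norm (f' x) \<le> C"
  shows "norm (f x - f y) \<le> C * \<bar>x - y\<bar>"
proof -
  have "onorm (\<lambda>h. h *\<^sub>R f' x) \<le> C" for x
  proof (rule onorm_le)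
    fix h show "norm (h *\<^sub>R f' x) \<le> C * norm h"
      using mult_left_mono[OF assms(2)[of x], of "\<bar>h\<bar>"] by (simp add: mult.commute)
  qed
  then have "norm (f x - f y) \<le> C * norm (x - y)"
    using assms(1) unfolding has_vector_derivative_def
    by (intro differentiable_bound[of UNIV f "\<lambda>x h. h *\<^sub>R f' x"]) auto
  then show ?thesis by simp
qed

text \<open>Dominated convergence along sequences tending to \<open>t\<close>. The mean value
  inequality makes the constant \<open>C\<close> dominate every difference quotient, which is why
  \<open>deriv\<close> and \<open>bound\<close> range over all \<open>s\<close>; a constant is
  integrable for a probability measure.\<close>

lemma (in prob_space) has_vector_derivative_integral:
  fixes h :: "real \<Rightarrow> 'a \<Rightarrow> 'b::{banach, second_countable_topology}"
  assumes int: "\<And>s. integrable M (h s)"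
    and deriv: "\<And>s x. x \<in> space M \<Longrightarrow> ((\<lambda>s. h s x) has_vector_derivative h' s x) (at s)"
    and bound: "\<And>s x. x \<in> space M \<Longrightarrow> norm (h' s x) \<le> C"
    and meas: "h' t \<in> borel_measurable M"
  shows "((\<lambda>s. \<integral>x. h s x \<partial>M) has_vector_derivative (\<integral>x. h' t x \<partial>M)) (at t)"
  unfolding has_vector_derivative_iff_quotient tendsto_at_iff_sequentially
proof (intro allI impI)
  fix X :: "nat \<Rightarrow> real"
  assume X: "\<forall>i. X i \<in> UNIV - {t}" and lim: "X \<longlonglongrightarrow> t"
  have "(\<lambda>i. \<integral>x. (h (X i) x - h t x) /\<^sub>R (X i - t) \<partial>M) \<longlonglongrightarrow> (\<integral>x. h' t x \<partial>M)"
  proof (rule integral_dominated_convergence[where w = "\<lambda>_. C"])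
    show "AE x in M. (\<lambda>i. (h (X i) x - h t x) /\<^sub>R (X i - t)) \<longlonglongrightarrow> h' t x"
    proof (rule AE_I2)
      fix x assume x: "x \<in> space M"
      show "(\<lambda>i. (h (X i) x - h t x) /\<^sub>R (X i - t)) \<longlonglongrightarrow> h' t x"
        using deriv[OF x, of t] X lim
        unfolding has_vector_derivative_iff_quotient tendsto_at_iff_sequentially comp_def by blast
    qed
    show "AE x in M. norm ((h (X i) x - h t x) /\<^sub>R (X i - t)) \<le> C" for i
    proof (rule AE_I2)
      fix x assume x: "x \<in> space M"
      have "X i \<noteq> t" using X by auto
      moreover have "norm (h (X i) x - h t x) \<le> C * \<bar>X i - t\<bar>"
        by (rule norm_diff_le_of_vector_derivative[OF deriv[OF x] bound[OF x]])
      moreover have "norm ((h (X i) x - h t x) /\<^sub>R (X i - t)) = norm (h (X i) x - h t x) / \<bar>X i - t\<bar>"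
        by (simp add: divide_inverse)
      ultimately show "norm ((h (X i) x - h t x) /\<^sub>R (X i - t)) \<le> C"
        by (simp add: pos_divide_le_eq)
    qed
    show "(\<lambda>x. (h (X i) x - h t x) /\<^sub>R (X i - t)) \<in> borel_measurable M" for i
      using int[of "X i"] int[of t] by measurable
  qed (use meas in auto)
  then show "((\<lambda>y. ((\<integral>x. h y x \<partial>M) - (\<integral>x. h t x \<partial>M)) /\<^sub>R (y - t)) \<circ> X) \<longlonglongrightarrow> (\<integral>x. h' t x \<partial>M)"
    by (simp add: comp_def int)
qed

section \<open>Characteristic functions and an approximate Stein equation\<close>

lemma has_vector_derivative_iexp_mult:
  "((\<lambda>x. iexp (c * x)) has_vector_derivative \<i> * c * iexp (c * x)) (at x)"
proof -
  have "((\<lambda>x. c * x) has_vector_derivative c) (at x)"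
    by (auto intro!: derivative_eq_intros simp: has_real_derivative_iff_has_vector_derivative[symmetric])
  from vector_diff_chain_at[OF this has_vector_derivative_iexp]
  show ?thesis by (simp add: comp_def scaleR_conv_of_real mult_ac)
qed

text \<open>Since \<phi>' = i E[W exp(i t W)], the hypothesis \<open>stein\<close> bounds \<phi>' +
  t \<phi>. The integrating factor exp(t^2/2) turns this into a bound on the derivative of
  \<open>\<psi>\<close>, which starts from the value 1 at 0. Boundedness of \<open>W\<close>
  justifies differentiating under the integral.\<close>

lemma (in prob_space) char_close_to_normal:
  fixes W :: "'a \<Rightarrow> real"
  assumes meas [measurable]: "W \<in> borel_measurable M"
    and bound: "\<And>x. x \<in> space M \<Longrightarrow> \<bar>W x\<bar> \<le> C"
    and stein: "\<And>t. norm ((\<integral>x. W x * iexp (t * W x) \<partial>M) - \<i> * t * (\<integral>x. iexp (t * W x) \<partial>M)) \<le> \<epsilon> * (1 + \<bar>t\<bar>)"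
  shows "norm ((\<integral>x. iexp (t * W x) \<partial>M) - complex_of_real (exp (- (t\<^sup>2) / 2))) \<le> \<epsilon> * (1 + \<bar>t\<bar>) * exp (t\<^sup>2 / 2) * \<bar>t\<bar>"
proof -
  define \<phi> where "\<phi> = (\<lambda>t::real. \<integral>x. iexp (t * W x) \<partial>M)"
  define \<psi> where "\<psi> = (\<lambda>t. \<phi> t * complex_of_real (exp (t\<^sup>2 / 2)))"
  \<comment> \<open>Here i times the bracket is \<phi>' + t \<phi>, so this is the product-rule
    derivative of \<open>\<psi>\<close>, written so that \<open>stein\<close> applies to it.\<close>
  define \<psi>' where "\<psi>' = (\<lambda>t. \<i> * ((\<integral>x. W x * iexp (t * W x) \<partial>M) - \<i> * t * \<phi> t) * complex_of_real (exp (t\<^sup>2 / 2)))"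
  have "0 \<le> \<epsilon>"
    using order_trans[OF norm_ge_zero stein[of 0]] by simp
  have d\<phi>: "(\<phi> has_vector_derivative (\<integral>x. \<i> * W x * iexp (s * W x) \<partial>M)) (at s)" for s
    unfolding \<phi>_def
  proof (rule has_vector_derivative_integral)
    show "integrable M (\<lambda>x. iexp (s * W x))" for s
      by (rule integrable_const_bound[where B = 1]) auto
    show "((\<lambda>s. iexp (s * W x)) has_vector_derivative \<i> * W x * iexp (s * W x)) (at s)" for s x
      using has_vector_derivative_iexp_mult[of "W x" s] by (simp add: mult_ac)
    show "norm (\<i> * W x * iexp (s * W x)) \<le> C" if "x \<in> space M" for x s
      using bound[OF that] by (simp add: norm_mult)
  qed auto
  have d\<psi>: "(\<psi> has_vector_derivative \<psi>' s) (at s)" for s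
  proof -
    have e: "((\<lambda>t. complex_of_real (exp (t\<^sup>2 / 2))) has_vector_derivative complex_of_real (s * exp (s\<^sup>2 / 2))) (at s)"
      by (rule has_vector_derivative_of_real) (auto intro!: derivative_eq_intros simp: has_real_derivative_iff_has_vector_derivative[symmetric])
    have "(\<integral>x. \<i> * W x * iexp (s * W x) \<partial>M) = \<i> * (\<integral>x. W x * iexp (s * W x) \<partial>M)"
      by (simp add: mult.assoc)
    then show ?thesis
      using has_vector_derivative_mult[OF d\<phi>[of s] e]
      unfolding \<psi>_def \<psi>'_def by (simp add: algebra_simps)
  qed
  have b: "norm (\<psi>' s) \<le> \<epsilon> * (1 + \<bar>t\<bar>) * exp (t\<^sup>2 / 2)" if "\<bar>s\<bar> \<le> \<bar>t\<bar>" for s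
  proof -
    have "s\<^sup>2 \<le> t\<^sup>2" using that by (simp add: abs_le_square_iff)
    have "norm (\<psi>' s) = norm ((\<integral>x. W x * iexp (s * W x) \<partial>M) - \<i> * s * \<phi> s) * exp (s\<^sup>2 / 2)"
      by (simp add: \<psi>'_def norm_mult)
    also have "\<dots> \<le> \<epsilon> * (1 + \<bar>s\<bar>) * exp (t\<^sup>2 / 2)"
      using stein[of s] \<open>s\<^sup>2 \<le> t\<^sup>2\<close> \<open>0 \<le> \<epsilon>\<close> unfolding \<phi>_def by (intro mult_mono) auto
    also have "\<dots> \<le> \<epsilon> * (1 + \<bar>t\<bar>) * exp (t\<^sup>2 / 2)"
      using that \<open>0 \<le> \<epsilon>\<close> by (intro mult_right_mono mult_left_mono) auto
    finally show ?thesis .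
  qed
  have "norm (\<psi> t - \<psi> 0) \<le> (\<epsilon> * (1 + \<bar>t\<bar>) * exp (t\<^sup>2 / 2)) * norm (t - 0)"
  proof (rule differentiable_bound[where S = "{-\<bar>t\<bar>..\<bar>t\<bar>}" and f' = "\<lambda>x h. h *\<^sub>R \<psi>' x"])
    show "(\<psi> has_derivative (\<lambda>h. h *\<^sub>R \<psi>' x)) (at x within {-\<bar>t\<bar>..\<bar>t\<bar>})" for x
      using d\<psi>[of x] unfolding has_vector_derivative_def by (rule has_derivative_at_withinI)
    show "onorm (\<lambda>h. h *\<^sub>R \<psi>' x) \<le> \<epsilon> * (1 + \<bar>t\<bar>) * exp (t\<^sup>2 / 2)" if "x \<in> {-\<bar>t\<bar>..\<bar>t\<bar>}" for x
    proof (rule onorm_le)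
      have "norm (\<psi>' x) \<le> \<epsilon> * (1 + \<bar>t\<bar>) * exp (t\<^sup>2 / 2)"
        using that by (intro b) auto
      from mult_left_mono[OF this, of "\<bar>h\<bar>" for h]
      show "norm (h *\<^sub>R \<psi>' x) \<le> \<epsilon> * (1 + \<bar>t\<bar>) * exp (t\<^sup>2 / 2) * norm h" for h
        by (simp add: mult_ac)
    qed
  qed auto
  moreover have "\<psi> 0 = 1"
    by (simp add: \<psi>_def \<phi>_def prob_space)
  moreover have "\<phi> t - complex_of_real (exp (- (t\<^sup>2) / 2)) = (\<psi> t - 1) * complex_of_real (exp (- (t\<^sup>2) / 2))"
    by (simp add: \<psi>_def left_diff_distrib mult.assoc flip: of_real_mult exp_add)
  moreover have "exp (- (t\<^sup>2) / 2) \<le> 1" by simp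
  ultimately have "norm (\<phi> t - complex_of_real (exp (- (t\<^sup>2) / 2))) \<le> (\<epsilon> * (1 + \<bar>t\<bar>) * exp (t\<^sup>2 / 2) * \<bar>t\<bar>) * 1"
    using \<open>0 \<le> \<epsilon>\<close>
    by (simp only: norm_mult norm_of_real abs_exp_cancel) (rule mult_mono, auto)
  then show ?thesis by (simp add: \<phi>_def)
qed

section \<open>Fixed points and 2-cycles of a uniform permutation\<close>

lemma card_permutes_fixing:
  assumes "i < n"
  shows "n * card {\<sigma>. \<sigma> permutes {..<n} \<and> \<sigma> i = i} = fact n"
proof -
  have "{\<sigma>. \<sigma> permutes {..<n} \<and> \<sigma> i = i} = {\<sigma>. \<sigma> permutes ({..<n} - {i})}"
    by (auto intro: permutes_subset permutes_superset simp: permutes_not_in)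
  then have "card {\<sigma>. \<sigma> permutes {..<n} \<and> \<sigma> i = i} = fact (n - 1)"
    using assms card_permutations[of "{..<n} - {i}" "n - 1"] by simp
  then show ?thesis using assms by (simp add: fact_reduce)
qed

text \<open>Pairs (\<sigma>, k) with \<sigma> in the set and k \<noteq> \<sigma> i inject into all
  permutations: follow \<sigma> by the transposition of i and k. The result still sends i to
  \<sigma> i, and sends \<sigma> i to k, so applying it twice to i recovers k and then \<sigma>. The
  value k = i is allowed, so each \<sigma> has n - 1 partners.\<close>

lemma card_permutes_two_cycle:
  assumes "i < n"
  shows "(n - 1) * card {\<sigma>. \<sigma> permutes {..<n} \<and> \<sigma> (\<sigma> i) = i \<and> \<sigma> i \<noteq> i} \<le> fact n"
proof -
  define E where "E = {\<sigma>. \<sigma> permutes {..<n} \<and> \<sigma> (\<sigma> i) = i \<and> \<sigma> i \<noteq> i}"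
  define T where "T = (SIGMA \<sigma>:E. {..<n} - {\<sigma> i})"
  define f where "f = (\<lambda>(\<sigma>, k). Transposition.transpose i k \<circ> \<sigma> :: nat \<Rightarrow> nat)"
  have fin: "finite {\<sigma>. \<sigma> permutes {..<n}}" by (simp add: finite_permutations)
  have finE: "finite E" by (rule finite_subset[OF _ fin]) (auto simp: E_def)
  have in_range: "\<sigma> i < n" if "\<sigma> \<in> E" for \<sigma>
    using permutes_in_image[of \<sigma> "{..<n}" i] that assms by (simp add: E_def)
  have ret: "f (\<sigma>, k) (f (\<sigma>, k) i) = k" if "(\<sigma>, k) \<in> T" for \<sigma> k
    using that by (auto simp: T_def E_def f_def Transposition.transpose_def)
  have "inj_on f T"
  proof (rule inj_onI, clarify)
    fix \<sigma> k \<tau> l assume A: "(\<sigma>, k) \<in> T" "(\<tau>, l) \<in> T" "f (\<sigma>, k) = f (\<tau>, l)"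
    then have "k = l" using ret by metis
    with A(3) have "Transposition.transpose i k \<circ> (Transposition.transpose i k \<circ> \<sigma>) = Transposition.transpose i k \<circ> (Transposition.transpose i k \<circ> \<tau>)"
      by (simp add: f_def)
    then have "\<sigma> = \<tau>" by (simp add: fun_eq_iff)
    with \<open>k = l\<close> show "\<sigma> = \<tau> \<and> k = l" by simp
  qed
  moreover have "f ` T \<subseteq> {\<sigma>. \<sigma> permutes {..<n}}"
    using assms by (auto simp: T_def E_def f_def intro!: permutes_compose permutes_swap_id)
  ultimately have "card T \<le> card {\<sigma>. \<sigma> permutes {..<n}}"
    using fin by (metis card_inj_on_le)
  moreover have "card T = (\<Sum>\<sigma>\<in>E. n - 1)"
    unfolding T_def using finE in_range by (subst card_SigmaI) (auto intro!: sum.cong)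
  ultimately show ?thesis
    by (simp add: card_permutations[of "{..<n}" n] E_def mult.commute)
qed

text \<open>This is the trace of \<open>perm_mat n \<sigma>\<close>; tr P and tr P^2 enter all
  estimates in this form.\<close>

definition num_fixed :: "nat \<Rightarrow> (nat \<Rightarrow> nat) \<Rightarrow> nat" where
  "num_fixed n \<sigma> = card {k. k < n \<and> \<sigma> k = k}"

text \<open>Double counting of pairs (\<sigma>, k) with \<sigma> k = k: each k is fixed by one n-th
  of the permutations, so the mean number of fixed points is 1.\<close>

lemma sum_num_fixed_permutes:
  assumes "0 < n"
  shows "(\<Sum>\<sigma> | \<sigma> permutes {..<n}. real (num_fixed n \<sigma>)) = fact n"
proof -
  have fin: "finite {\<sigma>. \<sigma> permutes {..<n}}" by (simp add: finite_permutations)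
  have "(\<Sum>\<sigma> | \<sigma> permutes {..<n}. card {k \<in> {..<n}. \<sigma> k = k})
      = (\<Sum>k<n. card {\<sigma> \<in> {\<sigma>. \<sigma> permutes {..<n}}. \<sigma> k = k})"
    by (rule sum_multicount_gen) (use fin in auto)
  also have "n * \<dots> = (\<Sum>k<n. fact n)"
    unfolding sum_distrib_left using card_permutes_fixing by (intro sum.cong) auto
  finally have "(\<Sum>\<sigma> | \<sigma> permutes {..<n}. card {k. k < n \<and> \<sigma> k = k}) = fact n"
    using assms by simp
  then have "real (\<Sum>\<sigma> | \<sigma> permutes {..<n}. card {k. k < n \<and> \<sigma> k = k}) = real (fact n)"
    by (simp only:)
  then show ?thesis by (simp add: num_fixed_def)
qed

text \<open>A fixed point of \<open>\<sigma> \<circ> \<sigma>\<close> is either fixed by \<sigma> or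
  lies on a 2-cycle. For each k the first case accounts for n!/n permutations and the second for at
  most n!/(n-1) \<le> 2 n!/n, whence the factor 3.\<close>

lemma sum_num_fixed_square_permutes:
  assumes "2 \<le> n"
  shows "(\<Sum>\<sigma> | \<sigma> permutes {..<n}. real (num_fixed n (\<sigma> \<circ> \<sigma>))) \<le> 3 * fact n"
proof -
  have fin: "finite {\<sigma>. \<sigma> permutes {..<n}}" by (simp add: finite_permutations)
  have "(\<Sum>\<sigma> | \<sigma> permutes {..<n}. card {k \<in> {..<n}. \<sigma> (\<sigma> k) = k})
      = (\<Sum>k<n. card {\<sigma> \<in> {\<sigma>. \<sigma> permutes {..<n}}. \<sigma> (\<sigma> k) = k})"
    by (rule sum_multicount_gen) (use fin in auto)
  also have "n * \<dots> \<le> (\<Sum>k<n. 3 * fact n)"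
    unfolding sum_distrib_left
  proof (rule sum_mono)
    fix k assume "k \<in> {..<n}" then have k: "k < n" by simp
    define A where "A = card {\<sigma>. \<sigma> permutes {..<n} \<and> \<sigma> k = k}"
    define B where "B = card {\<sigma>. \<sigma> permutes {..<n} \<and> \<sigma> (\<sigma> k) = k \<and> \<sigma> k \<noteq> k}"
    have "{\<sigma> \<in> {\<sigma>. \<sigma> permutes {..<n}}. \<sigma> (\<sigma> k) = k}
        = {\<sigma>. \<sigma> permutes {..<n} \<and> \<sigma> k = k} \<union> {\<sigma>. \<sigma> permutes {..<n} \<and> \<sigma> (\<sigma> k) = k \<and> \<sigma> k \<noteq> k}"
      by auto
    then have "card {\<sigma> \<in> {\<sigma>. \<sigma> permutes {..<n}}. \<sigma> (\<sigma> k) = k} \<le> A + B"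
      unfolding A_def B_def by (simp add: card_Un_le)
    then have "n * card {\<sigma> \<in> {\<sigma>. \<sigma> permutes {..<n}}. \<sigma> (\<sigma> k) = k} \<le> n * A + n * B"
      unfolding add_mult_distrib2[symmetric] by (rule mult_le_mono2)
    moreover have "n * A = fact n"
      using card_permutes_fixing[OF k] by (simp add: A_def)
    moreover have "n * B \<le> 2 * ((n - 1) * B)"
      unfolding mult.assoc[symmetric] using assms by (intro mult_le_mono) auto
    moreover have "(n - 1) * B \<le> fact n"
      using card_permutes_two_cycle[OF k] by (simp add: B_def)
    ultimately show "n * card {\<sigma> \<in> {\<sigma>. \<sigma> permutes {..<n}}. \<sigma> (\<sigma> k) = k} \<le> 3 * fact n"
      by linarith
  qed
  finally have "(\<Sum>\<sigma> | \<sigma> permutes {..<n}. card {k. k < n \<and> \<sigma> (\<sigma> k) = k}) \<le> 3 * fact n"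
    using assms by simp
  then have "real (\<Sum>\<sigma> | \<sigma> permutes {..<n}. card {k. k < n \<and> \<sigma> (\<sigma> k) = k}) \<le> real (3 * fact n)"
    by (simp only: of_nat_le_iff)
  then show ?thesis by (simp add: num_fixed_def)
qed

section \<open>Orthogonal matrices and the entries of A = M P M^T\<close>

definition conj_entry :: "nat \<Rightarrow> (nat \<Rightarrow> nat) \<Rightarrow> (nat \<Rightarrow> nat \<Rightarrow> real) \<Rightarrow> nat \<Rightarrow> nat \<Rightarrow> real" where
  "conj_entry n \<sigma> M i j = (\<Sum>k<n. M i k * M j (\<sigma> k))"

text \<open>Row l of \<open>perm_mat n \<sigma>\<close> has its 1 in column \<sigma> l, so one of
  the two sums collapses. This lets A be handled through the single sum
  \<open>conj_entry\<close>.\<close>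

lemma mat_mult_perm_transpose:
  assumes "\<sigma> permutes {..<n}" "i < n" "j < n"
  shows "mat_mult n (mat_mult n M (perm_mat n \<sigma>)) (mat_transpose n M) i j = conj_entry n \<sigma> M i j"
proof -
  have lt: "\<sigma> l < n" if "l < n" for l
    using permutes_in_image[OF assms(1), of l] that by simp
  have "mat_mult n (mat_mult n M (perm_mat n \<sigma>)) (mat_transpose n M) i j
      = (\<Sum>k<n. \<Sum>l<n. if k = \<sigma> l then M i l * M j k else 0)"
    using assms by (auto simp: mat_mult_def perm_mat_def mat_transpose_def sum_distrib_right intro!: sum.cong)
  also have "\<dots> = (\<Sum>l<n. \<Sum>k<n. if k = \<sigma> l then M i l * M j k else 0)"
    by (rule sum.swap)
  also have "\<dots> = conj_entry n \<sigma> M i j"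
    unfolding conj_entry_def using lt by (intro sum.cong) auto
  finally show ?thesis .
qed

lemma orth_mats_rows:
  assumes "M \<in> orth_mats n" "i < n" "j < n"
  shows "(\<Sum>k<n. M i k * M j k) = (if i = j then 1 else 0)"
proof -
  have "mat_mult n M (mat_transpose n M) i j = id_mat n i j"
    using assms by (simp add: orth_mats_def)
  then show ?thesis
    using assms by (simp add: mat_mult_def mat_transpose_def id_mat_def)
qed

lemma orth_matsI:
  assumes "\<And>i j. n \<le> i \<or> n \<le> j \<Longrightarrow> M i j = 0"
    and "\<And>i j. i < n \<Longrightarrow> j < n \<Longrightarrow> (\<Sum>k<n. M i k * M j k) = (if i = j then 1 else 0)"
  shows "M \<in> orth_mats n"
  using assms by (auto simp: orth_mats_def mat_mult_def mat_transpose_def id_mat_def fun_eq_iff)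

text \<open>With \<open>N = M\<^sup>T M\<close> one has \<open>tr (N\<^sup>2) = tr N = n\<close>, so the squared
  Frobenius norm of \<open>N - I\<close> vanishes.\<close>

lemma orth_mats_columns:
  assumes M: "M \<in> orth_mats n" and "k < n" "l < n"
  shows "(\<Sum>i<n. M i k * M i l) = (if k = l then 1 else 0)"
proof -
  define N where "N = (\<lambda>k l. \<Sum>i<n. M i k * M i l)"
  define \<delta> :: "nat \<Rightarrow> nat \<Rightarrow> real" where "\<delta> = (\<lambda>k l. if k = l then 1 else 0)"
  \<comment> \<open>Exchanging the order of summation turns tr((M^T M)^2) into tr((M M^T)^2), which
    row orthonormality evaluates.\<close>
  have "(\<Sum>k<n. \<Sum>l<n. (N k l)\<^sup>2) = (\<Sum>k<n. \<Sum>l<n. \<Sum>i<n. \<Sum>j<n. (M i k * M j k) * (M i l * M j l))"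
    by (simp add: N_def power2_eq_square sum_product mult_ac)
  also have "\<dots> = (\<Sum>k<n. \<Sum>i<n. \<Sum>l<n. \<Sum>j<n. (M i k * M j k) * (M i l * M j l))"
    by (intro sum.cong refl sum.swap)
  also have "\<dots> = (\<Sum>i<n. \<Sum>k<n. \<Sum>l<n. \<Sum>j<n. (M i k * M j k) * (M i l * M j l))"
    by (rule sum.swap)
  also have "\<dots> = (\<Sum>i<n. \<Sum>k<n. \<Sum>j<n. \<Sum>l<n. (M i k * M j k) * (M i l * M j l))"
    by (intro sum.cong refl sum.swap)
  also have "\<dots> = (\<Sum>i<n. \<Sum>j<n. \<Sum>k<n. \<Sum>l<n. (M i k * M j k) * (M i l * M j l))"
    by (intro sum.cong refl sum.swap)
  also have "\<dots> = (\<Sum>i<n. \<Sum>j<n. (\<Sum>k<n. M i k * M j k)\<^sup>2)"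
    by (simp add: power2_eq_square sum_product)
  also have "\<dots> = (\<Sum>i<n. \<Sum>j<n. if i = j then 1 else 0)"
    using orth_mats_rows[OF M] by (intro sum.cong) auto
  finally have sq: "(\<Sum>k<n. \<Sum>l<n. (N k l)\<^sup>2) = n" by simp
  have "(\<Sum>k<n. N k k) = (\<Sum>i<n. \<Sum>k<n. M i k * M i k)"
    unfolding N_def by (rule sum.swap)
  also have "\<dots> = n"
    using orth_mats_rows[OF M] by simp
  finally have tr: "(\<Sum>k<n. N k k) = n" .
  have "(\<Sum>k<n. \<Sum>l<n. (N k l - \<delta> k l)\<^sup>2)
      = (\<Sum>k<n. \<Sum>l<n. (N k l)\<^sup>2 - 2 * (if k = l then N k k else 0) + \<delta> k l)"
    by (intro sum.cong refl) (auto simp: \<delta>_def power2_eq_square algebra_simps)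
  also have "\<dots> = (\<Sum>k<n. \<Sum>l<n. (N k l)\<^sup>2) - 2 * (\<Sum>k<n. N k k) + n"
    by (simp add: sum.distrib sum_subtractf \<delta>_def flip: sum_distrib_left)
  also have "\<dots> = 0"
    using sq tr by simp
  finally have "(\<Sum>k<n. \<Sum>l<n. (N k l - \<delta> k l)\<^sup>2) = 0" .
  then have "\<forall>k\<in>{..<n}. (\<Sum>l<n. (N k l - \<delta> k l)\<^sup>2) = 0"
    by (subst (asm) sum_nonneg_eq_0_iff) (auto intro: sum_nonneg)
  then have "(\<Sum>l<n. (N k l - \<delta> k l)\<^sup>2) = 0"
    using assms by simp
  then have "\<forall>l\<in>{..<n}. (N k l - \<delta> k l)\<^sup>2 = 0"
    by (subst (asm) sum_nonneg_eq_0_iff) auto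
  then have "N k l = \<delta> k l"
    using assms by simp
  then show ?thesis by (simp add: N_def \<delta>_def)
qed

text \<open>The factors are the coordinates of u and v in the orthonormal basis of rows of
  \<open>M\<close>. After expansion, column orthonormality collapses the double sum over k and
  l.\<close>

lemma orth_mats_parseval:
  assumes M: "M \<in> orth_mats n"
  shows "(\<Sum>j<n. (\<Sum>k<n. u k * M j k) * (\<Sum>l<n. v l * M j l)) = (\<Sum>k<n. u k * v k)"
proof -
  have "(\<Sum>j<n. (\<Sum>k<n. u k * M j k) * (\<Sum>l<n. v l * M j l))
      = (\<Sum>j<n. \<Sum>k<n. \<Sum>l<n. (u k * v l) * (M j k * M j l))"
    by (simp add: sum_product mult_ac)
  also have "\<dots> = (\<Sum>k<n. \<Sum>j<n. \<Sum>l<n. (u k * v l) * (M j k * M j l))"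
    by (rule sum.swap)
  also have "\<dots> = (\<Sum>k<n. \<Sum>l<n. \<Sum>j<n. (u k * v l) * (M j k * M j l))"
    by (intro sum.cong refl sum.swap)
  also have "\<dots> = (\<Sum>k<n. \<Sum>l<n. (u k * v l) * (if k = l then 1 else 0))"
    using orth_mats_columns[OF M] by (simp flip: sum_distrib_left)
  also have "\<dots> = (\<Sum>k<n. u k * v k)"
    by (intro sum.cong) (auto simp: if_distrib cong: if_cong)
  finally show ?thesis .
qed

context
  fixes n :: nat and \<sigma> :: "nat \<Rightarrow> nat" and M :: "nat \<Rightarrow> nat \<Rightarrow> real"
  assumes perm: "\<sigma> permutes {..<n}" and M: "M \<in> orth_mats n"
begin

text \<open>Moving the permutation onto the factor of row \<open>i\<close> exhibits the entry as a
  coordinate with respect to row \<open>j\<close>, the shape \<open>orth_mats_parseval\<close> needs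
  for sums over \<open>j\<close>.\<close>

lemma conj_entry_eq_inv: "conj_entry n \<sigma> M i j = (\<Sum>k<n. M i (inv \<sigma> k) * M j k)"
  unfolding conj_entry_def
  using sum.permute[OF perm, of "\<lambda>k. M i (inv \<sigma> k) * M j k"] permutes_inverses(2)[OF perm]
  by (simp add: comp_def)

text \<open>A is orthogonal: by Parseval the sum is the squared norm of row \<open>i\<close> of
  \<open>M\<close> with its coordinates permuted.\<close>

lemma sum_conj_entry_row_sq:
  assumes "i < n"
  shows "(\<Sum>j<n. (conj_entry n \<sigma> M i j)\<^sup>2) = 1"
proof -
  have "(\<Sum>j<n. (conj_entry n \<sigma> M i j)\<^sup>2) = (\<Sum>k<n. M i (inv \<sigma> k) * M i (inv \<sigma> k))"
    unfolding conj_entry_eq_inv power2_eq_square by (rule orth_mats_parseval[OF M])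
  also have "\<dots> = (\<Sum>k<n. M i k * M i k)"
    using sum.permute[OF permutes_inv[OF perm], of "\<lambda>k. M i k * M i k"] by (simp add: comp_def)
  finally show ?thesis using orth_mats_rows[OF M assms assms] by simp
qed

lemma sum_conj_entry_column_sq:
  assumes "j < n"
  shows "(\<Sum>i<n. (conj_entry n \<sigma> M i j)\<^sup>2) = 1"
proof -
  have "(\<Sum>i<n. (conj_entry n \<sigma> M i j)\<^sup>2)
      = (\<Sum>i<n. (\<Sum>k<n. M j (\<sigma> k) * M i k) * (\<Sum>k<n. M j (\<sigma> k) * M i k))"
    by (simp add: conj_entry_def power2_eq_square mult.commute)
  also have "\<dots> = (\<Sum>k<n. M j (\<sigma> k) * M j (\<sigma> k))"
    by (rule orth_mats_parseval[OF M])
  also have "\<dots> = (\<Sum>k<n. M j k * M j k)"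
    using sum.permute[OF perm, of "\<lambda>k. M j k * M j k"] by (simp add: comp_def)
  finally show ?thesis using orth_mats_rows[OF M assms assms] by simp
qed

lemma abs_conj_entry_le:
  assumes "i < n" "j < n"
  shows "\<bar>conj_entry n \<sigma> M i j\<bar> \<le> 1"
proof -
  have "(conj_entry n \<sigma> M i j)\<^sup>2 \<le> (\<Sum>j<n. (conj_entry n \<sigma> M i j)\<^sup>2)"
    using assms by (intro member_le_sum) auto
  then show ?thesis
    using sum_conj_entry_row_sq[OF assms(1)] by (simp add: abs_square_le_1)
qed

text \<open>This is (A^2)_ii = (M P^2 M^T)_ii, where Parseval plays the role of M^T M = I. It is how
  P^2 enters the diagonal case.\<close>

lemma sum_conj_entry_swap:
  "(\<Sum>j<n. conj_entry n \<sigma> M i j * conj_entry n \<sigma> M j i) = conj_entry n (\<sigma> \<circ> \<sigma>) M i i"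
proof -
  have "(\<Sum>j<n. conj_entry n \<sigma> M i j * conj_entry n \<sigma> M j i)
      = (\<Sum>j<n. (\<Sum>k<n. M i (inv \<sigma> k) * M j k) * (\<Sum>k<n. M i (\<sigma> k) * M j k))"
    unfolding conj_entry_eq_inv[of i] by (simp add: conj_entry_def mult.commute)
  also have "\<dots> = (\<Sum>k<n. M i (inv \<sigma> k) * M i (\<sigma> k))"
    by (rule orth_mats_parseval[OF M])
  also have "\<dots> = (\<Sum>k<n. M i k * M i (\<sigma> (\<sigma> k)))"
    using sum.permute[OF perm, of "\<lambda>k. M i (inv \<sigma> k) * M i (\<sigma> k)"] permutes_inverses(2)[OF perm]
    by (simp add: comp_def)
  finally show ?thesis by (simp add: conj_entry_def)
qed

text \<open>Invariance of the trace, tr(M P M^T) = tr P, by column orthonormality.\<close>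

lemma sum_conj_entry_diag:
  "(\<Sum>j<n. conj_entry n \<sigma> M j j) = num_fixed n \<sigma>"
proof -
  have lt: "\<sigma> l < n" if "l < n" for l
    using permutes_in_image[OF perm, of l] that by simp
  have "(\<Sum>j<n. conj_entry n \<sigma> M j j) = (\<Sum>k<n. \<Sum>j<n. M j k * M j (\<sigma> k))"
    unfolding conj_entry_def by (rule sum.swap)
  also have "\<dots> = (\<Sum>k<n. if \<sigma> k = k then 1 else 0)"
    using orth_mats_columns[OF M] lt by (intro sum.cong) auto
  also have "\<dots> = card ({..<n} \<inter> {k. \<sigma> k = k})"
    by (simp add: sum.If_cases)
  also have "{..<n} \<inter> {k. \<sigma> k = k} = {k. k < n \<and> \<sigma> k = k}" by auto
  also have "card \<dots> = num_fixed n \<sigma>" by (simp add: num_fixed_def)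
  finally show ?thesis .
qed

end

section \<open>Plane rotations and the derivative of A along them\<close>

definition rot_mat :: "nat \<Rightarrow> nat \<Rightarrow> nat \<Rightarrow> real \<Rightarrow> nat \<Rightarrow> nat \<Rightarrow> real" where
  "rot_mat n i j \<theta> = (\<lambda>p q. if p < n \<and> q < n then
      (if p = i then (if q = i then cos \<theta> else if q = j then sin \<theta> else 0)
       else if p = j then (if q = i then - sin \<theta> else if q = j then cos \<theta> else 0)
       else if p = q then 1 else 0) else 0)"

lemma sum_rot_mat:
  fixes f :: "nat \<Rightarrow> real"
  assumes "i < n" "j < n" "i \<noteq> j" "p < n"
  shows "(\<Sum>k<n. rot_mat n i j \<theta> p k * f k) =
    (if p = i then cos \<theta> * f i + sin \<theta> * f j
     else if p = j then - sin \<theta> * f i + cos \<theta> * f j else f p)"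
proof -
  \<comment> \<open>Row \<open>p\<close> can be nonzero only in columns \<open>i\<close>,
    \<open>j\<close> and \<open>p\<close>. The third summand is switched off for \<open>p\<close>
    equal to \<open>i\<close> or \<open>j\<close>, so that no column is counted twice.\<close>
  have "(\<Sum>k<n. rot_mat n i j \<theta> p k * f k) = (\<Sum>k<n.
      (if k = i then rot_mat n i j \<theta> p i * f i else 0) +
      (if k = j then rot_mat n i j \<theta> p j * f j else 0) +
      (if k = p then (if p = i \<or> p = j then 0 else f p) else 0))"
    using assms by (intro sum.cong refl) (auto simp: rot_mat_def)
  also have "\<dots> = rot_mat n i j \<theta> p i * f i + rot_mat n i j \<theta> p j * f j
     + (if p = i \<or> p = j then 0 else f p)"
    unfolding sum.distrib using assms by (subst (1 2 3) sum.delta) auto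
  finally have "(\<Sum>k<n. rot_mat n i j \<theta> p k * f k) = rot_mat n i j \<theta> p i * f i
     + rot_mat n i j \<theta> p j * f j + (if p = i \<or> p = j then 0 else f p)" .
  then show ?thesis
    using assms by (auto simp: rot_mat_def)
qed

lemma rot_mat_orth:
  assumes "i < n" "j < n" "i \<noteq> j"
  shows "rot_mat n i j \<theta> \<in> orth_mats n"
proof (rule orth_matsI)
  have cs: "cos \<theta> * cos \<theta> + sin \<theta> * sin \<theta> = 1" "sin \<theta> * sin \<theta> + cos \<theta> * cos \<theta> = 1"
    by (simp_all flip: power2_eq_square)
  fix p q assume "p < n" "q < n"
  with assms show "(\<Sum>k<n. rot_mat n i j \<theta> p k * rot_mat n i j \<theta> q k) = (if p = q then 1 else 0)"
    by (subst sum_rot_mat) (auto simp: rot_mat_def cs)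
qed (auto simp: rot_mat_def)

lemma mat_mult_rot_mat:
  assumes "i < n" "j < n" "i \<noteq> j" "p < n" "k < n"
  shows "mat_mult n (rot_mat n i j \<theta>) M p k =
    (if p = i then cos \<theta> * M i k + sin \<theta> * M j k
     else if p = j then - sin \<theta> * M i k + cos \<theta> * M j k else M p k)"
  using assms sum_rot_mat[of i n j p \<theta> "\<lambda>q. M q k"] by (simp add: mat_mult_def)

lemma mat_mult_orth:
  assumes Q: "Q \<in> orth_mats n" and M: "M \<in> orth_mats n"
  shows "mat_mult n Q M \<in> orth_mats n"
proof (rule orth_matsI)
  fix i j assume ij: "i < n" "j < n"
  have "(\<Sum>k<n. mat_mult n Q M i k * mat_mult n Q M j k)
      = (\<Sum>k<n. \<Sum>p<n. \<Sum>q<n. (Q i p * Q j q) * (M p k * M q k))"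
    using ij by (simp add: mat_mult_def sum_product mult_ac)
  also have "\<dots> = (\<Sum>p<n. \<Sum>k<n. \<Sum>q<n. (Q i p * Q j q) * (M p k * M q k))"
    by (rule sum.swap)
  also have "\<dots> = (\<Sum>p<n. \<Sum>q<n. \<Sum>k<n. (Q i p * Q j q) * (M p k * M q k))"
    by (intro sum.cong refl sum.swap)
  also have "\<dots> = (\<Sum>p<n. \<Sum>q<n. (Q i p * Q j q) * (if p = q then 1 else 0))"
    using orth_mats_rows[OF M] by (simp flip: sum_distrib_left)
  also have "\<dots> = (\<Sum>p<n. Q i p * Q j p)"
    by (intro sum.cong) (auto simp: if_distrib cong: if_cong)
  also have "\<dots> = (if i = j then 1 else 0)"
    using orth_mats_rows[OF Q] ij by simp
  finally show "(\<Sum>k<n. mat_mult n Q M i k * mat_mult n Q M j k) = (if i = j then 1 else 0)" .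
qed (auto simp: mat_mult_def)

text \<open>The entries of \<open>J A - A J\<close> for \<open>A = M P M\<^sup>T\<close>, where \<open>J = e\<^sub>i e\<^sub>j\<^sup>T - e\<^sub>j e\<^sub>i\<^sup>T\<close>
  generates the rotations \<^const>\<open>rot_mat\<close>.\<close>

definition conj_entry_deriv ::
    "nat \<Rightarrow> (nat \<Rightarrow> nat) \<Rightarrow> nat \<Rightarrow> nat \<Rightarrow> (nat \<Rightarrow> nat \<Rightarrow> real) \<Rightarrow> nat \<Rightarrow> nat \<Rightarrow> real" where
  "conj_entry_deriv n \<sigma> i j M p q =
    (if p = i then conj_entry n \<sigma> M j q else if p = j then - conj_entry n \<sigma> M i q else 0) +
    (if q = i then conj_entry n \<sigma> M p j else if q = j then - conj_entry n \<sigma> M p i else 0)"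

text \<open>The rotated rows satisfy R_i' = R_j and R_j' = -R_i, the others being constant; the rest
  is the product rule. Rotations form a one-parameter group, so one formula, evaluated at
  \<open>R \<theta>\<close>, serves every \<theta>, as differentiation under the integral
  requires.\<close>

lemma conj_entry_has_derivative:
  fixes M :: "nat \<Rightarrow> nat \<Rightarrow> real"
  assumes perm: "\<sigma> permutes {..<n}" and ij: "i < n" "j < n" "i \<noteq> j" and pq: "p < n" "q < n"
  defines "R \<equiv> \<lambda>\<theta>. mat_mult n (rot_mat n i j \<theta>) M"
  shows "((\<lambda>\<theta>. conj_entry n \<sigma> (R \<theta>) p q) has_real_derivative conj_entry_deriv n \<sigma> i j (R \<theta>) p q) (at \<theta>)"
proof -
  define R' where "R' = (\<lambda>\<theta> p k. if p = i then R \<theta> j k else if p = j then - R \<theta> i k else 0)"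
  have lt: "\<sigma> l < n" if "l < n" for l
    using permutes_in_image[OF perm, of l] that by simp
  have d: "((\<lambda>\<theta>. R \<theta> p k) has_real_derivative R' \<theta> p k) (at \<theta>)" if "p < n" "k < n" for p k \<theta>
  proof -
    consider "p = i" | "p = j" "p \<noteq> i" | "p \<noteq> i" "p \<noteq> j" by blast
    then show ?thesis
      using ij that unfolding R_def R'_def
      by cases (auto simp: mat_mult_rot_mat intro!: derivative_eq_intros)
  qed
  have "((\<lambda>\<theta>. conj_entry n \<sigma> (R \<theta>) p q) has_real_derivative
      (\<Sum>k<n. R' \<theta> p k * R \<theta> q (\<sigma> k) + R' \<theta> q (\<sigma> k) * R \<theta> p k)) (at \<theta>)"
    unfolding conj_entry_def using pq lt by (intro DERIV_sum DERIV_mult d) auto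
  also have "(\<Sum>k<n. R' \<theta> p k * R \<theta> q (\<sigma> k) + R' \<theta> q (\<sigma> k) * R \<theta> p k)
      = conj_entry_deriv n \<sigma> i j (R \<theta>) p q"
    by (simp add: R'_def conj_entry_deriv_def conj_entry_def sum.distrib sum_negf mult.commute)
  finally show ?thesis .
qed

lemma abs_conj_entry_deriv_le:
  assumes "\<sigma> permutes {..<n}" "M \<in> orth_mats n" "i < n" "j < n" "p < n" "q < n"
  shows "\<bar>conj_entry_deriv n \<sigma> i j M p q\<bar> \<le> 2"
proof -
  have "\<bar>conj_entry n \<sigma> M p' q'\<bar> \<le> 1" if "p' < n" "q' < n" for p' q'
    using abs_conj_entry_le[OF assms(1,2)] that by blast
  then have "\<bar>if p = i then conj_entry n \<sigma> M j q else if p = j then - conj_entry n \<sigma> M i q else 0\<bar> \<le> 1"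
    "\<bar>if q = i then conj_entry n \<sigma> M p j else if q = j then - conj_entry n \<sigma> M p i else 0\<bar> \<le> 1"
    using assms by auto
  then show ?thesis unfolding conj_entry_deriv_def by linarith
qed

section \<open>Haar measure: measurability and the consequence of rotation invariance\<close>

lemma borel_measurable_entry [measurable]:
  "(\<lambda>M :: nat \<Rightarrow> nat \<Rightarrow> real. M i j) \<in> borel_measurable borel"
  by (intro borel_measurable_continuous_onI)
    (rule continuous_on_product_then_coordinatewise[OF continuous_on_product_coordinates])

lemma borel_measurable_mat_mult:
  "mat_mult n Q \<in> borel_measurable borel"
proof (intro borel_measurable_continuous_onI continuous_on_coordinatewise_then_product)
  have entry: "continuous_on UNIV (\<lambda>M :: nat \<Rightarrow> nat \<Rightarrow> real. M i j)" for i j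
    by (rule continuous_on_product_then_coordinatewise[OF continuous_on_product_coordinates])
  show "continuous_on UNIV (\<lambda>M. mat_mult n Q M i j)" for i j
    unfolding mat_mult_def by (cases "i < n \<and> j < n") (auto intro!: continuous_intros entry)
qed

locale haar =
  fixes n :: nat and \<mu> :: "(nat \<Rightarrow> nat \<Rightarrow> real) measure"
  assumes haar: "haar_orth n \<mu>"
begin

sublocale prob_space \<mu>
  using haar by (simp add: haar_orth_def)

lemma sets_haar: "sets \<mu> = sets (restrict_space borel (orth_mats n))"
  using haar by (simp add: haar_orth_def)

lemma space_haar: "space \<mu> = orth_mats n"
  using sets_eq_imp_space_eq[OF sets_haar] by (simp add: space_restrict_space)

lemma measurable_haar: "f \<in> measurable borel N \<Longrightarrow> f \<in> measurable \<mu> N"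
  unfolding measurable_cong_sets[OF sets_haar refl] by (rule measurable_restrict_space1)

lemma measurable_haar_entry [measurable]: "(\<lambda>M. M i j) \<in> borel_measurable \<mu>"
  by (rule measurable_haar) simp

lemma measurable_conj_entry [measurable]: "(\<lambda>M. conj_entry n \<sigma> M i j) \<in> borel_measurable \<mu>"
  unfolding conj_entry_def by measurable

lemma measurable_conj_entry_deriv [measurable]:
  "(\<lambda>M. conj_entry_deriv n \<sigma> i j M p q) \<in> borel_measurable \<mu>"
  unfolding conj_entry_deriv_def by measurable

lemma measurable_mat_mult_haar:
  assumes "Q \<in> orth_mats n"
  shows "mat_mult n Q \<in> measurable \<mu> \<mu>"
  unfolding measurable_cong_sets[OF refl sets_haar]
  using assms mat_mult_orth
  by (intro measurable_restrict_space2 measurable_haar borel_measurable_mat_mult) (auto simp: space_haar)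

lemma integral_mat_mult:
  fixes F :: "(nat \<Rightarrow> nat \<Rightarrow> real) \<Rightarrow> 'b::{banach, second_countable_topology}"
  assumes Q: "Q \<in> orth_mats n" and F: "F \<in> borel_measurable \<mu>"
  shows "(\<integral>M. F (mat_mult n Q M) \<partial>\<mu>) = (\<integral>M. F M \<partial>\<mu>)"
proof -
  have "distr \<mu> \<mu> (mat_mult n Q) = \<mu>"
    using haar Q by (simp add: haar_orth_def)
  with integral_distr[OF measurable_mat_mult_haar[OF Q] F] show ?thesis by simp
qed

text \<open>By left invariance the mean of A_rs g(A_pq) at the rotated matrix does not depend on
  \<theta>, so its derivative at 0 vanishes; \<open>F'\<close> is the integrand of that derivative.
  Bounds on \<open>g\<close> and \<open>g'\<close> over [-1, 1] suffice because entries of A lie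
  there, so g(x) = x is admissible. Integrability is recorded for summing such identities.\<close>

lemma rotation_identity:
  fixes g g' :: "real \<Rightarrow> 'b::{banach, second_countable_topology}"
  assumes perm: "\<sigma> permutes {..<n}" and ij: "i < n" "j < n" "i \<noteq> j"
    and idx: "p < n" "q < n" "r < n" "s < n"
    and g: "\<And>x. (g has_vector_derivative g' x) (at x)"
    and gb: "\<And>x. \<bar>x\<bar> \<le> 1 \<Longrightarrow> norm (g x) \<le> B" "\<And>x. \<bar>x\<bar> \<le> 1 \<Longrightarrow> norm (g' x) \<le> B'"
    and [measurable]: "g' \<in> borel_measurable borel"
  defines "F' \<equiv> \<lambda>M. conj_entry_deriv n \<sigma> i j M r s *\<^sub>R g (conj_entry n \<sigma> M p q)
      + (conj_entry n \<sigma> M r s * conj_entry_deriv n \<sigma> i j M p q) *\<^sub>R g' (conj_entry n \<sigma> M p q)"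
  shows "integrable \<mu> F'" and "(\<integral>M. F' M \<partial>\<mu>) = 0"
proof -
  define F where "F = (\<lambda>M. conj_entry n \<sigma> M r s *\<^sub>R g (conj_entry n \<sigma> M p q))"
  define R where "R = (\<lambda>\<theta> M. mat_mult n (rot_mat n i j \<theta>) M)"
  have "continuous_on UNIV g"
    using g by (intro continuous_at_imp_continuous_on) (auto intro: has_vector_derivative_continuous)
  then have [measurable]: "g \<in> borel_measurable borel"
    by (rule borel_measurable_continuous_onI)
  have F_meas [measurable]: "F \<in> borel_measurable \<mu>"
    unfolding F_def by measurable
  have F'_meas [measurable]: "F' \<in> borel_measurable \<mu>"
    unfolding F'_def by measurable
  have Rorth: "R \<theta> M \<in> orth_mats n" if "M \<in> space \<mu>" for \<theta> M
    using that ij unfolding R_def space_haar by (intro mat_mult_orth rot_mat_orth)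
  have R_meas [measurable]: "R \<theta> \<in> measurable \<mu> \<mu>" for \<theta>
    unfolding R_def by (intro measurable_mat_mult_haar rot_mat_orth ij)
  have B0: "0 \<le> B" "0 \<le> B'"
    using order_trans[OF norm_ge_zero gb(1)[of 0]] order_trans[OF norm_ge_zero gb(2)[of 0]] by simp_all
  have Fb: "norm (F M) \<le> B" if "M \<in> orth_mats n" for M
  proof -
    have "\<bar>conj_entry n \<sigma> M r s\<bar> * norm (g (conj_entry n \<sigma> M p q)) \<le> 1 * B"
      using abs_conj_entry_le[OF perm that] idx B0 by (intro mult_mono gb) auto
    then show ?thesis by (simp add: F_def)
  qed
  have F'b: "norm (F' M) \<le> 2 * B + 2 * B'" if "M \<in> orth_mats n" for M
  proof -
    have "\<bar>conj_entry_deriv n \<sigma> i j M r s\<bar> * norm (g (conj_entry n \<sigma> M p q)) \<le> 2 * B"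
      using abs_conj_entry_le[OF perm that] abs_conj_entry_deriv_le[OF perm that] idx ij B0
      by (intro mult_mono gb) auto
    moreover have "(\<bar>conj_entry n \<sigma> M r s\<bar> * \<bar>conj_entry_deriv n \<sigma> i j M p q\<bar>)
        * norm (g' (conj_entry n \<sigma> M p q)) \<le> (1 * 2) * B'"
      using abs_conj_entry_le[OF perm that] abs_conj_entry_deriv_le[OF perm that] idx ij B0
      by (intro mult_mono gb) auto
    ultimately show ?thesis
      unfolding F'_def by (intro norm_triangle_le) (simp add: abs_mult)
  qed
  show "integrable \<mu> F'"
    using F'b by (intro integrable_const_bound[where B = "2 * B + 2 * B'"]) (auto simp: space_haar)
  have "((\<lambda>\<theta>. \<integral>M. F (R \<theta> M) \<partial>\<mu>) has_vector_derivative (\<integral>M. F' (R 0 M) \<partial>\<mu>)) (at 0)"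
  proof (rule has_vector_derivative_integral)
    show "integrable \<mu> (\<lambda>M. F (R \<theta> M))" for \<theta>
      using Fb Rorth by (intro integrable_const_bound[where B = B]) auto
    show "norm (F' (R \<theta> M)) \<le> 2 * B + 2 * B'" if "M \<in> space \<mu>" for \<theta> M
      using F'b Rorth that by blast
    show "((\<lambda>\<theta>. F (R \<theta> M)) has_vector_derivative F' (R \<theta> M)) (at \<theta>)" for \<theta> M
    proof -
      have d: "((\<lambda>\<theta>. conj_entry n \<sigma> (R \<theta> M) p q) has_real_derivative
          conj_entry_deriv n \<sigma> i j (R \<theta> M) p q) (at \<theta>)" if "p < n" "q < n" for p q
        unfolding R_def by (rule conj_entry_has_derivative[OF perm ij that])
      have "((\<lambda>\<theta>. g (conj_entry n \<sigma> (R \<theta> M) p q)) has_vector_derivative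
          conj_entry_deriv n \<sigma> i j (R \<theta> M) p q *\<^sub>R g' (conj_entry n \<sigma> (R \<theta> M) p q)) (at \<theta>)"
        using vector_diff_chain_at[OF _ g] d[of p q] idx
        by (fastforce simp: has_real_derivative_iff_has_vector_derivative comp_def)
      from has_vector_derivative_scaleR[OF d[OF idx(3,4)] this]
      show ?thesis by (simp add: F_def F'_def add.commute)
    qed
  qed simp
  moreover have "(\<integral>M. F (R \<theta> M) \<partial>\<mu>) = (\<integral>M. F M \<partial>\<mu>)" for \<theta>
    unfolding R_def by (intro integral_mat_mult rot_mat_orth ij F_meas)
  ultimately have "((\<lambda>\<theta>. \<integral>M. F M \<partial>\<mu>) has_vector_derivative (\<integral>M. F' (R 0 M) \<partial>\<mu>)) (at (0::real))"
    by simp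
  then have "(\<integral>M. F' (R 0 M) \<partial>\<mu>) = 0"
    by (rule vector_derivative_unique_at) (rule has_vector_derivative_const)
  \<comment> \<open>Invariance is applied once more to remove the rotation by angle 0, in place of
    showing that it is the identity.\<close>
  then show "(\<integral>M. F' M \<partial>\<mu>) = 0"
    unfolding R_def by (simp add: integral_mat_mult rot_mat_orth ij)
qed

end

section \<open>From a Stein identity to a nearly normal characteristic function\<close>

text \<open>With c = t sqrt n, dividing \<open>stein\<close> by sqrt n gives the hypothesis of
  \<open>char_close_to_normal\<close> for W = sqrt n X. The \<open>K\<close> term contributes
  \<kappa> / sqrt n and the \<open>\<rho>\<close> term |t| \<eta>, both absorbed in (\<kappa> / sqrt
  n + \<eta>)(1 + |t|). The pointwise bound \<open>r\<close> gives integrability, while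
  \<open>\<eta>\<close> measures the actual size of the correction.\<close>

lemma (in prob_space) char_close_to_normal_of_stein_identity:
  fixes X K \<rho> :: "'a \<Rightarrow> real" and n :: nat
  assumes n: "0 < n"
    and [measurable]: "X \<in> borel_measurable M" "K \<in> borel_measurable M" "\<rho> \<in> borel_measurable M"
    and X: "\<And>x. x \<in> space M \<Longrightarrow> \<bar>X x\<bar> \<le> 1" and K: "\<And>x. x \<in> space M \<Longrightarrow> \<bar>K x\<bar> \<le> \<kappa>"
    and \<rho>: "\<And>x. x \<in> space M \<Longrightarrow> \<bar>\<rho> x\<bar> \<le> r" and \<rho>_int: "(\<integral>x. \<bar>\<rho> x\<bar> \<partial>M) \<le> \<eta>"
    and stein: "\<And>c::real. (\<integral>x. (K x - n * X x) *\<^sub>R iexp (c * X x)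
        + (1 + \<rho> x) *\<^sub>R (\<i> * c * iexp (c * X x)) \<partial>M) = 0"
  shows "norm ((\<integral>x. iexp (t * (sqrt n * X x)) \<partial>M) - complex_of_real (exp (- (t\<^sup>2) / 2)))
    \<le> (\<kappa> / sqrt n + \<eta>) * (1 + \<bar>t\<bar>) * exp (t\<^sup>2 / 2) * \<bar>t\<bar>"
proof (rule char_close_to_normal)
  show "\<bar>sqrt n * X x\<bar> \<le> sqrt n" if "x \<in> space M" for x
    using X[OF that] mult_left_mono[of "\<bar>X x\<bar>" 1 "sqrt n"] by (simp add: abs_mult)
  fix t :: real
  define c where "c = t * sqrt n"
  define G where "G = (\<lambda>x. iexp (c * X x))"
  have [measurable]: "G \<in> borel_measurable M" unfolding G_def by measurable
  have G1: "norm (G x) = 1" for x by (simp add: G_def)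
  have ex: "\<exists>x. x \<in> space M" using not_empty by blast
  have k0: "0 \<le> \<kappa>" using ex K order_trans[OF abs_ge_zero] by blast
  have e0: "0 \<le> \<eta>" using \<rho>_int order_trans[OF integral_nonneg_AE] by (metis (no_types, lifting) AE_I2 abs_ge_zero)
  have i\<rho>: "integrable M (\<lambda>x. \<bar>\<rho> x\<bar>)"
    using \<rho> by (intro integrable_const_bound[where B = r]) auto
  have iG: "integrable M G"
    by (intro integrable_const_bound[where B = 1]) (auto simp: G1)
  have iXG: "integrable M (\<lambda>x. X x * G x)"
    using X by (intro integrable_const_bound[where B = 1]) (auto simp: G1 norm_mult)
  have iKG: "integrable M (\<lambda>x. K x * G x)"
    using K by (intro integrable_const_bound[where B = \<kappa>]) (auto simp: G1 norm_mult)
  have i\<rho>G: "integrable M (\<lambda>x. \<rho> x * G x)"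
    using \<rho> by (intro integrable_const_bound[where B = r]) (auto simp: G1 norm_mult)
  have "0 = (\<integral>x. K x * G x - n * (X x * G x) + \<i> * c * G x + \<i> * c * (\<rho> x * G x) \<partial>M)"
    using stein[of c] by (simp add: G_def scaleR_conv_of_real algebra_simps)
  also have "\<dots> = (\<integral>x. K x * G x \<partial>M) - n * (\<integral>x. X x * G x \<partial>M) + \<i> * c * (\<integral>x. G x \<partial>M)
      + \<i> * c * (\<integral>x. \<rho> x * G x \<partial>M)"
    by (simp add: iG iXG iKG i\<rho>G)
  finally have eq: "n * (\<integral>x. X x * G x \<partial>M) - \<i> * c * (\<integral>x. G x \<partial>M)
      = (\<integral>x. K x * G x \<partial>M) + \<i> * c * (\<integral>x. \<rho> x * G x \<partial>M)"
    by (simp add: algebra_simps)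
  have bK: "norm (\<integral>x. K x * G x \<partial>M) \<le> \<kappa>"
  proof -
    have "norm (\<integral>x. K x * G x \<partial>M) \<le> (\<integral>x. norm (K x * G x) \<partial>M)"
      by (rule integral_norm_bound)
    also have "\<dots> \<le> (\<integral>x. \<kappa> \<partial>M)"
      using K integrable_norm[OF iKG] by (intro integral_mono) (auto simp: norm_mult G1)
    finally show ?thesis by (simp add: prob_space)
  qed
  have b\<rho>: "norm (\<integral>x. \<rho> x * G x \<partial>M) \<le> \<eta>"
  proof -
    have "norm (\<integral>x. \<rho> x * G x \<partial>M) \<le> (\<integral>x. norm (\<rho> x * G x) \<partial>M)"
      by (rule integral_norm_bound)
    also have "\<dots> = (\<integral>x. \<bar>\<rho> x\<bar> \<partial>M)"
      by (simp add: norm_mult G1)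
    finally show ?thesis using \<rho>_int by simp
  qed
  have sq: "complex_of_real (sqrt n) * complex_of_real (sqrt n) = n"
    by (simp flip: of_real_mult)
  have "sqrt n * norm ((\<integral>x. (sqrt n * X x) * G x \<partial>M) - \<i> * t * (\<integral>x. G x \<partial>M))
      = norm (sqrt n * ((\<integral>x. (sqrt n * X x) * G x \<partial>M) - \<i> * t * (\<integral>x. G x \<partial>M)))"
    by (simp add: norm_mult)
  also have "sqrt n * ((\<integral>x. (sqrt n * X x) * G x \<partial>M) - \<i> * t * (\<integral>x. G x \<partial>M))
      = n * (\<integral>x. X x * G x \<partial>M) - \<i> * c * (\<integral>x. G x \<partial>M)"
    unfolding sq[symmetric] by (simp add: c_def mult.assoc right_diff_distrib)
  also have "norm \<dots> \<le> \<kappa> + \<bar>c\<bar> * \<eta>"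
    unfolding eq using bK b\<rho>
    by (intro norm_triangle_le add_mono) (auto simp: norm_mult intro!: mult_left_mono)
  also have "\<dots> = sqrt n * (\<kappa> / sqrt n + \<bar>t\<bar> * \<eta>)"
    using n by (simp add: c_def abs_mult field_simps)
  also have "\<dots> \<le> sqrt n * ((\<kappa> / sqrt n + \<eta>) * (1 + \<bar>t\<bar>))"
    using k0 e0 by (intro mult_left_mono) (auto simp: distrib_left distrib_right)
  finally have "norm ((\<integral>x. (sqrt n * X x) * G x \<partial>M) - \<i> * t * (\<integral>x. G x \<partial>M)) \<le> (\<kappa> / sqrt n + \<eta>) * (1 + \<bar>t\<bar>)"
    using n by simp
  then show "norm ((\<integral>x. complex_of_real (sqrt n * X x) * iexp (t * (sqrt n * X x)) \<partial>M)
      - \<i> * t * (\<integral>x. iexp (t * (sqrt n * X x)) \<partial>M)) \<le> (\<kappa> / sqrt n + \<eta>) * (1 + \<bar>t\<bar>)"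
    by (simp add: G_def c_def mult.assoc)
qed measurable

section \<open>Stein identities for diagonal and off-diagonal entries\<close>

context haar
begin

lemma integrable_haar_bounded:
  fixes f :: "(nat \<Rightarrow> nat \<Rightarrow> real) \<Rightarrow> 'b::{banach, second_countable_topology}"
  assumes "f \<in> borel_measurable \<mu>" "\<And>M. M \<in> orth_mats n \<Longrightarrow> norm (f M) \<le> B"
  shows "integrable \<mu> f"
  using assms by (intro integrable_const_bound[where B = B]) (auto simp: space_haar)

context
  fixes \<sigma> :: "nat \<Rightarrow> nat" and g g' :: "real \<Rightarrow> 'b::{banach, second_countable_topology}" and B B' :: real
  assumes perm: "\<sigma> permutes {..<n}"
    and g: "\<And>x. (g has_vector_derivative g' x) (at x)"
    and gb: "\<And>x. \<bar>x\<bar> \<le> 1 \<Longrightarrow> norm (g x) \<le> B" "\<And>x. \<bar>x\<bar> \<le> 1 \<Longrightarrow> norm (g' x) \<le> B'"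
    and g'_meas: "g' \<in> borel_measurable borel"
begin

text \<open>Rotate rows \<open>a\<close> and \<open>j\<close> in A_aj g(A_aa) and sum over j
  \<noteq> a. The derivative A_jj - A_aa of A_aj sums to tr P - n A_aa. The derivative A_aj + A_ja
  of A_aa, weighted by A_aj, gives the unit row norm plus (A^2)_aa, less A_aa^2 twice for the
  missing index.\<close>

lemma stein_identity_diagonal:
  assumes a: "a < n"
  shows "(\<integral>M. (num_fixed n \<sigma> - n * conj_entry n \<sigma> M a a) *\<^sub>R g (conj_entry n \<sigma> M a a)
    + (1 + (conj_entry n (\<sigma> \<circ> \<sigma>) M a a - 2 * (conj_entry n \<sigma> M a a)\<^sup>2)) *\<^sub>R g' (conj_entry n \<sigma> M a a) \<partial>\<mu>) = 0"
    (is "integral\<^sup>L \<mu> ?I = 0")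
proof -
  define F where "F = (\<lambda>j M. conj_entry_deriv n \<sigma> a j M a j *\<^sub>R g (conj_entry n \<sigma> M a a)
      + (conj_entry n \<sigma> M a j * conj_entry_deriv n \<sigma> a j M a a) *\<^sub>R g' (conj_entry n \<sigma> M a a))"
  have F: "integrable \<mu> (F j)" "(\<integral>M. F j M \<partial>\<mu>) = 0" if "j \<in> {..<n} - {a}" for j
    using rotation_identity[OF perm a _ _ a a a _ g gb g'_meas, of j j] that unfolding F_def by auto
  have "?I M = (\<Sum>j\<in>{..<n} - {a}. F j M)" if "M \<in> space \<mu>" for M
  proof -
    have M: "M \<in> orth_mats n" using that by (simp add: space_haar)
    define A where "A = conj_entry n \<sigma> M"
    have rm: "(\<Sum>j\<in>{..<n} - {a}. f j) = (\<Sum>j<n. f j) - f a" for f :: "nat \<Rightarrow> real"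
      using a by (simp add: sum_diff1)
    have "(\<Sum>j\<in>{..<n} - {a}. F j M)
        = (\<Sum>j\<in>{..<n} - {a}. (A j j - A a a) *\<^sub>R g (A a a) + ((A a j)\<^sup>2 + A a j * A j a) *\<^sub>R g' (A a a))"
      by (intro sum.cong) (auto simp: F_def A_def conj_entry_deriv_def power2_eq_square algebra_simps)
    also have "\<dots> = (\<Sum>j\<in>{..<n} - {a}. A j j - A a a) *\<^sub>R g (A a a)
        + (\<Sum>j\<in>{..<n} - {a}. (A a j)\<^sup>2 + A a j * A j a) *\<^sub>R g' (A a a)"
      by (simp only: scaleR_sum_left) (rule sum.distrib)
    also have "(\<Sum>j\<in>{..<n} - {a}. A j j - A a a) = num_fixed n \<sigma> - n * A a a"
      using sum_conj_entry_diag[OF perm M] unfolding rm by (simp add: A_def sum_subtractf)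
    also have "(\<Sum>j\<in>{..<n} - {a}. (A a j)\<^sup>2 + A a j * A j a)
        = 1 + (conj_entry n (\<sigma> \<circ> \<sigma>) M a a - 2 * (A a a)\<^sup>2)"
      using sum_conj_entry_row_sq[OF perm M a] sum_conj_entry_swap[OF perm M, of a] unfolding rm
      by (simp add: A_def sum.distrib power2_eq_square)
    finally show ?thesis by (simp add: A_def)
  qed
  then have "integral\<^sup>L \<mu> ?I = (\<integral>M. (\<Sum>j\<in>{..<n} - {a}. F j M) \<partial>\<mu>)"
    by (intro Bochner_Integration.integral_cong) auto
  also have "\<dots> = (\<Sum>j\<in>{..<n} - {a}. \<integral>M. F j M \<partial>\<mu>)"
    by (intro Bochner_Integration.integral_sum F)
  finally show ?thesis using F(2) by simp
qed

text \<open>Rotate rows \<open>a\<close> and \<open>j\<close> in A_jb g(A_ab) and sum over the n - 2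
  indices j outside {a, b}. As b is not in the rotation plane, A_jb has derivative -A_ab and A_ab
  has derivative A_jb; no trace appears, and the unit norm of column \<open>b\<close> yields the
  second coefficient. Writing 2 A_ab apart from n A_ab fits the coefficient \<open>K\<close>
  above.\<close>

lemma stein_identity_off_diagonal:
  assumes a: "a < n" and b: "b < n" and ab: "a \<noteq> b"
  shows "(\<integral>M. (2 * conj_entry n \<sigma> M a b - n * conj_entry n \<sigma> M a b) *\<^sub>R g (conj_entry n \<sigma> M a b)
    + (1 + (- (conj_entry n \<sigma> M a b)\<^sup>2 - (conj_entry n \<sigma> M b b)\<^sup>2)) *\<^sub>R g' (conj_entry n \<sigma> M a b) \<partial>\<mu>) = 0"
    (is "integral\<^sup>L \<mu> ?I = 0")
proof -
  define F where "F = (\<lambda>j M. conj_entry_deriv n \<sigma> a j M j b *\<^sub>R g (conj_entry n \<sigma> M a b)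
      + (conj_entry n \<sigma> M j b * conj_entry_deriv n \<sigma> a j M a b) *\<^sub>R g' (conj_entry n \<sigma> M a b))"
  have F: "integrable \<mu> (F j)" "(\<integral>M. F j M \<partial>\<mu>) = 0" if "j \<in> {..<n} - {a} - {b}" for j
    using rotation_identity[OF perm a _ _ a b _ b g gb g'_meas, of j j] that unfolding F_def by auto
  have "?I M = (\<Sum>j\<in>{..<n} - {a} - {b}. F j M)" if "M \<in> space \<mu>" for M
  proof -
    have M: "M \<in> orth_mats n" using that by (simp add: space_haar)
    define A where "A = conj_entry n \<sigma> M"
    have rm: "(\<Sum>j\<in>{..<n} - {a} - {b}. f j) = (\<Sum>j<n. f j) - f a - f b" for f :: "nat \<Rightarrow> real"
      using a b ab by (simp add: sum_diff1)
    have "(\<Sum>j\<in>{..<n} - {a} - {b}. F j M)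
        = (\<Sum>j\<in>{..<n} - {a} - {b}. (- A a b) *\<^sub>R g (A a b) + (A j b)\<^sup>2 *\<^sub>R g' (A a b))"
      using ab by (intro sum.cong) (auto simp: F_def A_def conj_entry_deriv_def power2_eq_square)
    also have "\<dots> = (\<Sum>j\<in>{..<n} - {a} - {b}. - A a b) *\<^sub>R g (A a b)
        + (\<Sum>j\<in>{..<n} - {a} - {b}. (A j b)\<^sup>2) *\<^sub>R g' (A a b)"
      by (simp only: sum.distrib scaleR_sum_left)
    also have "(\<Sum>j\<in>{..<n} - {a} - {b}. - A a b) = 2 * A a b - n * A a b"
      unfolding rm by simp
    also have "(\<Sum>j\<in>{..<n} - {a} - {b}. (A j b)\<^sup>2) = 1 + (- (A a b)\<^sup>2 - (A b b)\<^sup>2)"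
      using sum_conj_entry_column_sq[OF perm M b] unfolding rm by (simp add: A_def)
    finally show ?thesis by (simp add: A_def)
  qed
  then have "integral\<^sup>L \<mu> ?I = (\<integral>M. (\<Sum>j\<in>{..<n} - {a} - {b}. F j M) \<partial>\<mu>)"
    by (intro Bochner_Integration.integral_cong) auto
  also have "\<dots> = (\<Sum>j\<in>{..<n} - {a} - {b}. \<integral>M. F j M \<partial>\<mu>)"
    by (intro Bochner_Integration.integral_sum F)
  finally show ?thesis using F(2) by simp
qed

end

end

text \<open>Collects the hypotheses on \<open>g\<close> in the order in which the Stein identities
  take them, with bounds 1 and |c|.\<close>

lemma has_bounded_derivative_iexp:
  "((\<lambda>x. iexp (c * x)) has_vector_derivative \<i> * c * iexp (c * x)) (at x)"
  "norm (iexp (c * x)) \<le> 1" "norm (\<i> * c * iexp (c * x)) \<le> \<bar>c\<bar>"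
  "(\<lambda>x. \<i> * c * iexp (c * x)) \<in> borel_measurable borel"
  using has_vector_derivative_iexp_mult[of c x] by (auto simp: norm_mult)

section \<open>Second moments and the characteristic function for a fixed permutation\<close>

context haar
begin

context
  fixes \<sigma> :: "nat \<Rightarrow> nat"
  assumes perm: "\<sigma> permutes {..<n}"
begin

lemma integrable_conj_entry_sq:
  assumes "a < n" "b < n"
  shows "integrable \<mu> (\<lambda>M. (conj_entry n \<sigma> M a b)\<^sup>2)"
  using abs_conj_entry_le[OF perm] assms
  by (intro integrable_haar_bounded[where B = 1]) (auto simp: abs_square_le_1)

text \<open>The Stein identity for g(x) = x expresses n E[A_aa^2] as the mean of tr P A_aa + 1 +
  (A^2)_aa - 2 A_aa^2, where |A_aa| and |(A^2)_aa| are at most 1.\<close>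

lemma second_moment_diagonal:
  assumes a: "a < n"
  shows "(\<integral>M. (conj_entry n \<sigma> M a a)\<^sup>2 \<partial>\<mu>) \<le> (real (num_fixed n \<sigma>) + 2) / n"
proof -
  have perm2: "\<sigma> \<circ> \<sigma> permutes {..<n}" by (intro permutes_compose perm)
  define A where "A = (\<lambda>M. conj_entry n \<sigma> M a a)"
  define A2 where "A2 = (\<lambda>M. conj_entry n (\<sigma> \<circ> \<sigma>) M a a)"
  define I where "I = (\<lambda>M. (num_fixed n \<sigma> - n * A M) * A M + (1 + (A2 M - 2 * (A M)\<^sup>2)))"
  have [measurable]: "A \<in> borel_measurable \<mu>" "A2 \<in> borel_measurable \<mu>"
    unfolding A_def A2_def by measurable
  have A: "\<bar>A M\<bar> \<le> 1" "\<bar>A2 M\<bar> \<le> 1" if "M \<in> orth_mats n" for M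
    unfolding A_def A2_def using abs_conj_entry_le[OF perm that] abs_conj_entry_le[OF perm2 that] a by auto
  have "integral\<^sup>L \<mu> I = 0"
    unfolding I_def A_def A2_def
    using stein_identity_diagonal[OF perm, of "\<lambda>x. x" "\<lambda>_. 1" 1 1 a] a by simp
  have iA: "integrable \<mu> A" "integrable \<mu> A2" "integrable \<mu> (\<lambda>M. (A M)\<^sup>2)"
    using A by (auto intro!: integrable_haar_bounded[where B = 1] simp: abs_square_le_1)
  have I_eq: "I M = num_fixed n \<sigma> * A M - n * (A M)\<^sup>2 + (1 + (A2 M - 2 * (A M)\<^sup>2))" for M
    by (simp add: I_def algebra_simps power2_eq_square)
  have "integrable \<mu> I"
    unfolding I_eq using iA by auto
  have "n * (\<integral>M. (A M)\<^sup>2 \<partial>\<mu>) = (\<integral>M. I M + n * (A M)\<^sup>2 \<partial>\<mu>)"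
    using \<open>integrable \<mu> I\<close> \<open>integral\<^sup>L \<mu> I = 0\<close> iA by simp
  also have "\<dots> \<le> (\<integral>M. real (num_fixed n \<sigma>) + 2 \<partial>\<mu>)"
  proof (rule integral_mono)
    fix M assume "M \<in> space \<mu>"
    then have M: "M \<in> orth_mats n" by (simp add: space_haar)
    have "num_fixed n \<sigma> * A M \<le> real (num_fixed n \<sigma>) * 1"
      using A(1)[OF M] by (intro mult_left_mono) auto
    then show "I M + n * (A M)\<^sup>2 \<le> real (num_fixed n \<sigma>) + 2"
      using A(2)[OF M] zero_le_power2[of "A M"] unfolding I_eq by linarith
  qed (use \<open>integrable \<mu> I\<close> iA in auto)
  also have "\<dots> = real (num_fixed n \<sigma>) + 2" by (simp add: prob_space)
  finally show ?thesis using a by (simp add: A_def field_simps)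
qed

text \<open>The Stein identity for g(x) = x gives n E[A_ab^2] = E[1 + A_ab^2 - A_bb^2], so the bound
  is uniform in the permutation.\<close>

lemma second_moment_off_diagonal:
  assumes a: "a < n" and b: "b < n" and ab: "a \<noteq> b"
  shows "(\<integral>M. (conj_entry n \<sigma> M a b)\<^sup>2 \<partial>\<mu>) \<le> 3 / n"
proof -
  define A where "A = (\<lambda>M. conj_entry n \<sigma> M a b)"
  define D where "D = (\<lambda>M. conj_entry n \<sigma> M b b)"
  define I where "I = (\<lambda>M. (2 * A M - n * A M) * A M + (1 + (- (A M)\<^sup>2 - (D M)\<^sup>2)))"
  have A: "\<bar>A M\<bar> \<le> 1" "\<bar>D M\<bar> \<le> 1" if "M \<in> orth_mats n" for M
    unfolding A_def D_def using abs_conj_entry_le[OF perm that] a b by auto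
  have "integral\<^sup>L \<mu> I = 0"
    unfolding I_def A_def D_def
    using stein_identity_off_diagonal[OF perm, of "\<lambda>x. x" "\<lambda>_. 1" 1 1 a b] a b ab by simp
  have iA: "integrable \<mu> (\<lambda>M. (A M)\<^sup>2)" "integrable \<mu> (\<lambda>M. (D M)\<^sup>2)"
    unfolding A_def D_def by (intro integrable_conj_entry_sq a b)+
  have I_eq: "I M = 2 * (A M)\<^sup>2 - n * (A M)\<^sup>2 + (1 + (- (A M)\<^sup>2 - (D M)\<^sup>2))" for M
    by (simp add: I_def algebra_simps power2_eq_square)
  have "integrable \<mu> I"
    unfolding I_eq using iA by auto
  have "n * (\<integral>M. (A M)\<^sup>2 \<partial>\<mu>) = (\<integral>M. I M + n * (A M)\<^sup>2 \<partial>\<mu>)"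
    using \<open>integrable \<mu> I\<close> \<open>integral\<^sup>L \<mu> I = 0\<close> iA by simp
  also have "\<dots> \<le> (\<integral>M. 3 \<partial>\<mu>)"
  proof (rule integral_mono)
    fix M assume "M \<in> space \<mu>"
    then have "(A M)\<^sup>2 \<le> 1" using A(1) by (simp add: space_haar abs_square_le_1)
    then show "I M + n * (A M)\<^sup>2 \<le> 3"
      using zero_le_power2[of "D M"] zero_le_power2[of "A M"] unfolding I_eq by linarith
  qed (use \<open>integrable \<mu> I\<close> iA in auto)
  also have "\<dots> = 3" by (simp add: prob_space)
  finally show ?thesis using a by (simp add: A_def field_simps)
qed

text \<open>The Stein identity with g(x) = exp(i c x) feeds
  \<open>char_close_to_normal_of_stein_identity\<close>. The coefficient \<open>K\<close> is tr P on
  the diagonal and 2 A_ab off it; the second moments make the mean of |\<rho>| of order 1 / sqrt n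
  for a fixed number of fixed points.\<close>

lemma char_conj_entry:
  assumes a: "a < n" and b: "b < n"
  shows "norm ((\<integral>M. iexp (t * (sqrt n * conj_entry n \<sigma> M a b)) \<partial>\<mu>) - complex_of_real (exp (- (t\<^sup>2) / 2)))
    \<le> (3 * real (num_fixed n \<sigma>) + real (num_fixed n (\<sigma> \<circ> \<sigma>)) + 7) / sqrt n * ((1 + \<bar>t\<bar>) * exp (t\<^sup>2 / 2) * \<bar>t\<bar>)"
proof -
  have perm2: "\<sigma> \<circ> \<sigma> permutes {..<n}" by (intro permutes_compose perm)
  define f where "f = real (num_fixed n \<sigma>)"
  define f2 where "f2 = real (num_fixed n (\<sigma> \<circ> \<sigma>))"
  define C where "C = (1 + \<bar>t\<bar>) * exp (t\<^sup>2 / 2) * \<bar>t\<bar>"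
  have C: "0 \<le> C" by (simp add: C_def)
  have n: "0 < n" "1 \<le> sqrt n" using a by auto
  have f0: "0 \<le> f" "0 \<le> f2" by (auto simp: f_def f2_def)
  have le_sqrt: "x / n \<le> x / sqrt n" if "0 \<le> x" for x :: real
  proof -
    have "sqrt n * 1 \<le> sqrt n * sqrt n" using n by (intro mult_left_mono) auto
    then show ?thesis using n that by (intro divide_left_mono) auto
  qed
  have sqrt_mult_div: "sqrt n * (x / n) = x / sqrt n" for x :: real
  proof -
    have "sqrt n * x * sqrt n = x * (sqrt n * sqrt n)" by (simp only: mult_ac)
    also have "\<dots> = x * n" by simp
    finally show ?thesis using n by (simp add: divide_simps)
  qed
  \<comment> \<open>Both cases end here. On the diagonal \<kappa> + \<eta> is 3 f + f2/2 + 11/2, off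
    the diagonal it is f + 7; this is where the constants of the bound come from.\<close>
  have main: ?thesis if "norm ((\<integral>M. iexp (t * (sqrt n * conj_entry n \<sigma> M a b)) \<partial>\<mu>) - complex_of_real (exp (- (t\<^sup>2) / 2)))
      \<le> (\<kappa> / sqrt n + \<eta> / sqrt n) * (1 + \<bar>t\<bar>) * exp (t\<^sup>2 / 2) * \<bar>t\<bar>" "\<kappa> + \<eta> \<le> 3 * f + f2 + 7" for \<kappa> \<eta>
  proof -
    have "(\<kappa> / sqrt n + \<eta> / sqrt n) * (1 + \<bar>t\<bar>) * exp (t\<^sup>2 / 2) * \<bar>t\<bar> = (\<kappa> + \<eta>) / sqrt n * C"
      by (simp add: C_def add_divide_distrib mult.assoc)
    also have "\<dots> \<le> (3 * f + f2 + 7) / sqrt n * C"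
      using that(2) C by (intro mult_right_mono divide_right_mono) auto
    finally show ?thesis using that(1) by (simp add: C_def f_def f2_def)
  qed
  show ?thesis
  proof (cases "a = b")
    case True
    define A where "A = (\<lambda>M. conj_entry n \<sigma> M a a)"
    define A2 where "A2 = (\<lambda>M. conj_entry n (\<sigma> \<circ> \<sigma>) M a a)"
    have [measurable]: "A \<in> borel_measurable \<mu>" "A2 \<in> borel_measurable \<mu>"
      unfolding A_def A2_def by measurable
    have A: "\<bar>A M\<bar> \<le> 1" "\<bar>A2 M\<bar> \<le> 1" if "M \<in> orth_mats n" for M
      unfolding A_def A2_def using abs_conj_entry_le[OF perm that] abs_conj_entry_le[OF perm2 that] a by auto
    have \<rho>b: "\<bar>A2 M - 2 * (A M)\<^sup>2\<bar> \<le> 3" if "M \<in> orth_mats n" for M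
    proof -
      have "(A M)\<^sup>2 \<le> 1" using A[OF that] by (simp add: abs_square_le_1)
      then show ?thesis using A(2)[OF that] zero_le_power2[of "A M"] by linarith
    qed
    have iA: "integrable \<mu> (\<lambda>M. (A M)\<^sup>2)" "integrable \<mu> (\<lambda>M. (A2 M)\<^sup>2)"
      using A by (auto intro!: integrable_haar_bounded[where B = 1] simp: abs_square_le_1)
    \<comment> \<open>AM-GM replaces the Cauchy--Schwarz bound on the mean of \<open>\<bar>A2\<bar>\<close>.\<close>
    have am_gm: "\<bar>x\<bar> \<le> (sqrt n * x\<^sup>2 + 1 / sqrt n) / 2" for x :: real
    proof -
      have "0 \<le> (sqrt n * \<bar>x\<bar> - 1)\<^sup>2 / sqrt n" by simp
      also have "\<dots> = sqrt n * x\<^sup>2 + 1 / sqrt n - 2 * \<bar>x\<bar>"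
        using n by (simp add: power2_eq_square field_simps)
      finally show ?thesis by simp
    qed
    have "(\<integral>M. \<bar>A2 M - 2 * (A M)\<^sup>2\<bar> \<partial>\<mu>) \<le> (\<integral>M. (sqrt n * (A2 M)\<^sup>2 + 1 / sqrt n) / 2 + 2 * (A M)\<^sup>2 \<partial>\<mu>)"
    proof (rule integral_mono)
      show "integrable \<mu> (\<lambda>M. \<bar>A2 M - 2 * (A M)\<^sup>2\<bar>)"
        using \<rho>b by (intro integrable_haar_bounded[where B = 3]) auto
      show "\<bar>A2 M - 2 * (A M)\<^sup>2\<bar> \<le> (sqrt n * (A2 M)\<^sup>2 + 1 / sqrt n) / 2 + 2 * (A M)\<^sup>2" for M
        using am_gm[of "A2 M"] zero_le_power2[of "A M"] by linarith
    qed (use iA in auto)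
    also have "\<dots> = (sqrt n * (\<integral>M. (A2 M)\<^sup>2 \<partial>\<mu>) + 1 / sqrt n) / 2 + 2 * (\<integral>M. (A M)\<^sup>2 \<partial>\<mu>)"
      using iA by (simp add: prob_space)
    \<comment> \<open>\<open>A2\<close> is a diagonal entry of M P^2 M^T, so the second moment bound
      is used again for \<open>\<sigma> \<circ> \<sigma>\<close>. The exported version is taken
      because \<sigma> is fixed in this context.\<close>
    also have "\<dots> \<le> (sqrt n * ((f2 + 2) / n) + 1 / sqrt n) / 2 + 2 * ((f + 2) / n)"
      using second_moment_diagonal[OF a] haar.second_moment_diagonal[OF haar_axioms perm2 a]
      unfolding A_def A2_def f_def f2_def by (intro add_mono divide_right_mono mult_left_mono) auto
    also have "\<dots> = ((f2 + 2) / sqrt n + 1 / sqrt n) / 2 + 2 * ((f + 2) / n)"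
      by (simp only: sqrt_mult_div)
    also have "\<dots> \<le> ((f2 + 2) / sqrt n + 1 / sqrt n) / 2 + 2 * ((f + 2) / sqrt n)"
      using f0 by (intro add_left_mono mult_left_mono le_sqrt) auto
    also have "\<dots> = (((f2 + 3) / 2 + 2 * (f + 2))) / sqrt n"
      by (simp add: add_divide_distrib)
    finally have \<eta>: "(\<integral>M. \<bar>A2 M - 2 * (A M)\<^sup>2\<bar> \<partial>\<mu>) \<le> ((f2 + 3) / 2 + 2 * (f + 2)) / sqrt n" .
    have "norm ((\<integral>M. iexp (t * (sqrt n * A M)) \<partial>\<mu>) - complex_of_real (exp (- (t\<^sup>2) / 2)))
      \<le> (f / sqrt n + ((f2 + 3) / 2 + 2 * (f + 2)) / sqrt n) * (1 + \<bar>t\<bar>) * exp (t\<^sup>2 / 2) * \<bar>t\<bar>"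
    proof (rule char_close_to_normal_of_stein_identity[where K = "\<lambda>_. f" and \<rho> = "\<lambda>M. A2 M - 2 * (A M)\<^sup>2" and r = 3])
      show "(\<integral>M. (f - n * A M) *\<^sub>R iexp (c * A M)
        + (1 + (A2 M - 2 * (A M)\<^sup>2)) *\<^sub>R (\<i> * c * iexp (c * A M)) \<partial>\<mu>) = 0" for c :: real
        unfolding A_def A2_def f_def
        by (rule stein_identity_diagonal[OF perm has_bounded_derivative_iexp a])
    qed (use n A f0 \<rho>b \<eta> in \<open>auto simp: space_haar\<close>)
    then show ?thesis
      using f0 True unfolding A_def by (intro main) auto
  next
    case False
    define A where "A = (\<lambda>M. conj_entry n \<sigma> M a b)"
    define D where "D = (\<lambda>M. conj_entry n \<sigma> M b b)"
    have [measurable]: "A \<in> borel_measurable \<mu>" "D \<in> borel_measurable \<mu>"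
      unfolding A_def D_def by measurable
    have A: "\<bar>A M\<bar> \<le> 1" "\<bar>D M\<bar> \<le> 1" if "M \<in> orth_mats n" for M
      unfolding A_def D_def using abs_conj_entry_le[OF perm that] a b by auto
    have \<rho>b: "\<bar>- (A M)\<^sup>2 - (D M)\<^sup>2\<bar> \<le> 2" if "M \<in> orth_mats n" for M
    proof -
      have "(A M)\<^sup>2 \<le> 1" "(D M)\<^sup>2 \<le> 1" using A[OF that] by (simp_all add: abs_square_le_1)
      then show ?thesis using zero_le_power2[of "D M"] zero_le_power2[of "A M"] by linarith
    qed
    have iA: "integrable \<mu> (\<lambda>M. (A M)\<^sup>2)" "integrable \<mu> (\<lambda>M. (D M)\<^sup>2)"
      unfolding A_def D_def by (intro integrable_conj_entry_sq a b)+
    have "\<bar>- (A M)\<^sup>2 - (D M)\<^sup>2\<bar> = (A M)\<^sup>2 + (D M)\<^sup>2" for M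
      using zero_le_power2[of "D M"] zero_le_power2[of "A M"] by linarith
    then have "(\<integral>M. \<bar>- (A M)\<^sup>2 - (D M)\<^sup>2\<bar> \<partial>\<mu>) = (\<integral>M. (A M)\<^sup>2 \<partial>\<mu>) + (\<integral>M. (D M)\<^sup>2 \<partial>\<mu>)"
      using iA by simp
    also have "\<dots> \<le> 3 / n + (f + 2) / n"
      using second_moment_off_diagonal[OF a b False] second_moment_diagonal[OF b]
      by (simp add: A_def D_def f_def)
    also have "\<dots> \<le> 3 / sqrt n + (f + 2) / sqrt n"
      using f0 by (intro add_mono le_sqrt) auto
    also have "\<dots> = (f + 5) / sqrt n"
      by (simp add: add_divide_distrib)
    finally have \<eta>: "(\<integral>M. \<bar>- (A M)\<^sup>2 - (D M)\<^sup>2\<bar> \<partial>\<mu>) \<le> (f + 5) / sqrt n" .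
    have "norm ((\<integral>M. iexp (t * (sqrt n * A M)) \<partial>\<mu>) - complex_of_real (exp (- (t\<^sup>2) / 2)))
      \<le> (2 / sqrt n + (f + 5) / sqrt n) * (1 + \<bar>t\<bar>) * exp (t\<^sup>2 / 2) * \<bar>t\<bar>"
    proof (rule char_close_to_normal_of_stein_identity[where K = "\<lambda>M. 2 * A M" and \<rho> = "\<lambda>M. - (A M)\<^sup>2 - (D M)\<^sup>2" and r = 2])
      show "(\<integral>M. (2 * A M - n * A M) *\<^sub>R iexp (c * A M)
        + (1 + (- (A M)\<^sup>2 - (D M)\<^sup>2)) *\<^sub>R (\<i> * c * iexp (c * A M)) \<partial>\<mu>) = 0" for c :: real
        unfolding A_def D_def
        by (rule stein_identity_off_diagonal[OF perm has_bounded_derivative_iexp a b False])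
    qed (use n A f0 \<rho>b \<eta> in \<open>auto simp: space_haar abs_mult\<close>)
    then show ?thesis
      using f0 unfolding A_def by (intro main) auto
  qed
qed

end

end

section \<open>Averaging over the permutation and passage to the limit\<close>

text \<open>By Fubini the characteristic function is the average over \<sigma> of those in
  \<open>char_conj_entry\<close>. The mean numbers of fixed points of \<sigma> and of its square are
  1 and at most 3, so the constant is 3 * 1 + 3 + 7 = 13. Values of \<open>f\<close> are prescribed
  on permutations, where the uniform law is supported.\<close>

lemma (in haar) char_conj_uniform_perm:
  fixes f :: "(nat \<Rightarrow> nat \<Rightarrow> real) \<times> (nat \<Rightarrow> nat) \<Rightarrow> real"
  assumes a: "a < n" and b: "b < n" and n: "2 \<le> n"
    and f_meas [measurable]: "f \<in> borel_measurable (\<mu> \<Otimes>\<^sub>M measure_pmf (unif_perm n))"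
    and f: "\<And>M \<sigma>. \<sigma> permutes {..<n} \<Longrightarrow> f (M, \<sigma>) = sqrt n * conj_entry n \<sigma> M a b"
  shows "norm (char (distr (\<mu> \<Otimes>\<^sub>M measure_pmf (unif_perm n)) borel f) t - complex_of_real (exp (- (t\<^sup>2) / 2)))
    \<le> 13 / sqrt n * ((1 + \<bar>t\<bar>) * exp (t\<^sup>2 / 2) * \<bar>t\<bar>)"
proof -
  define S where "S = {\<sigma>. \<sigma> permutes {..<n}}"
  have S: "finite S" "S \<noteq> {}" "card S = fact n"
    unfolding S_def using permutes_id[of "{..<n}"]
    by (auto simp: finite_permutations card_permutations[of "{..<n}" n] simp del: permutes_id)
  have set_S: "set_pmf (unif_perm n) = S"
    unfolding unif_perm_def S_def[symmetric] using S by (simp add: set_pmf_of_set)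
  define C where "C = (1 + \<bar>t\<bar>) * exp (t\<^sup>2 / 2) * \<bar>t\<bar>"
  have C: "0 \<le> C" by (simp add: C_def)
  define z where "z = complex_of_real (exp (- (t\<^sup>2) / 2))"
  define \<phi> where "\<phi> = (\<lambda>\<sigma>. \<integral>M. iexp (t * f (M, \<sigma>)) \<partial>\<mu>)"
  define \<epsilon> where "\<epsilon> = (\<lambda>\<sigma>. (3 * real (num_fixed n \<sigma>) + real (num_fixed n (\<sigma> \<circ> \<sigma>)) + 7) / sqrt n * C)"
  interpret P: pair_prob_space \<mu> "measure_pmf (unif_perm n)"
    by unfold_locales
  have int: "integrable (measure_pmf (unif_perm n)) h" for h :: "(nat \<Rightarrow> nat) \<Rightarrow> 'c::{banach, second_countable_topology}"
    using S by (intro integrable_measure_pmf_finite) (simp add: set_S)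
  have "char (distr (\<mu> \<Otimes>\<^sub>M measure_pmf (unif_perm n)) borel f) t
      = (\<integral>x. iexp (t * f x) \<partial>(\<mu> \<Otimes>\<^sub>M measure_pmf (unif_perm n)))"
    unfolding char_def by (rule integral_distr) (auto intro: f_meas)
  also have "\<dots> = (\<integral>\<sigma>. \<phi> \<sigma> \<partial>measure_pmf (unif_perm n))"
  proof -
    have "integrable (\<mu> \<Otimes>\<^sub>M measure_pmf (unif_perm n)) (\<lambda>x. iexp (t * f x))"
      by (rule P.integrable_const_bound[where B = 1]) auto
    then show ?thesis
      using P.integral_snd[of "\<lambda>M \<sigma>. iexp (t * f (M, \<sigma>))"] by (simp add: \<phi>_def case_prod_unfold)
  qed
  finally have "char (distr (\<mu> \<Otimes>\<^sub>M measure_pmf (unif_perm n)) borel f) t - z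
      = (\<integral>\<sigma>. \<phi> \<sigma> - z \<partial>measure_pmf (unif_perm n))"
    by (simp add: int)
  also have "norm \<dots> \<le> (\<integral>\<sigma>. norm (\<phi> \<sigma> - z) \<partial>measure_pmf (unif_perm n))"
    by (rule integral_norm_bound)
  also have "\<dots> \<le> (\<integral>\<sigma>. \<epsilon> \<sigma> \<partial>measure_pmf (unif_perm n))"
  proof (rule integral_mono_AE[OF int int])
    show "AE \<sigma> in measure_pmf (unif_perm n). norm (\<phi> \<sigma> - z) \<le> \<epsilon> \<sigma>"
      unfolding AE_measure_pmf_iff set_S
    proof
      fix \<sigma> assume "\<sigma> \<in> S"
      then have p: "\<sigma> permutes {..<n}" by (simp add: S_def)
      show "norm (\<phi> \<sigma> - z) \<le> \<epsilon> \<sigma>"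
        using char_conj_entry[OF p a b, of t] by (simp add: \<phi>_def z_def \<epsilon>_def C_def f[OF p])
    qed
  qed
  also have "\<dots> = (\<Sum>\<sigma>\<in>S. \<epsilon> \<sigma>) / fact n"
    unfolding unif_perm_def S_def[symmetric] using integral_pmf_of_set[OF S(2,1), of \<epsilon>] S(3) by simp
  also have "(\<Sum>\<sigma>\<in>S. \<epsilon> \<sigma>) = (3 * (\<Sum>\<sigma>\<in>S. real (num_fixed n \<sigma>))
      + (\<Sum>\<sigma>\<in>S. real (num_fixed n (\<sigma> \<circ> \<sigma>))) + 7 * fact n) / sqrt n * C"
    using S(3) by (simp add: \<epsilon>_def sum.distrib sum_distrib_left flip: sum_distrib_right sum_divide_distrib)
  also have "\<dots> \<le> (3 * fact n + 3 * fact n + 7 * fact n) / sqrt n * C"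
    using sum_num_fixed_permutes[of n] sum_num_fixed_square_permutes[OF n] n C
    unfolding S_def by (intro mult_right_mono divide_right_mono) auto
  finally have "norm (char (distr (\<mu> \<Otimes>\<^sub>M measure_pmf (unif_perm n)) borel f) t - z)
      \<le> (3 * fact n + 3 * fact n + 7 * fact n) / sqrt n * C / fact n"
    by (simp add: divide_right_mono)
  also have "\<dots> = 13 / sqrt n * C"
    by simp
  finally show ?thesis by (simp add: z_def C_def)
qed

text \<open>Every function of \<sigma> is measurable, as \<open>measure_pmf\<close> carries all
  subsets; what remains are finite sums of products of entries.\<close>

lemma (in haar) measurable_conj_perm:
  "(\<lambda>(M, \<sigma>). sqrt (real n) * mat_mult n (mat_mult n M (perm_mat n \<sigma>)) (mat_transpose n M) a b)
    \<in> borel_measurable (\<mu> \<Otimes>\<^sub>M measure_pmf p)"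
proof -
  have [measurable]: "(\<lambda>x. fst x i j) \<in> borel_measurable (\<mu> \<Otimes>\<^sub>M measure_pmf p)" for i j
    by (rule measurable_compose[OF measurable_fst]) simp
  have [measurable]: "(\<lambda>x. perm_mat n (snd x) i j) \<in> borel_measurable (\<mu> \<Otimes>\<^sub>M measure_pmf p)" for i j
    by (rule measurable_compose[OF measurable_snd]) simp
  show ?thesis
    unfolding mat_mult_def mat_transpose_def case_prod_unfold by measurable
qed

theorem theorem2p6:
  fixes \<mu> :: "nat \<Rightarrow> (nat \<Rightarrow> nat \<Rightarrow> real) measure" and a b :: nat
  assumes "\<And>n. haar_orth n (\<mu> n)"
  shows "weak_conv_m
           (\<lambda>n. distr (\<mu> n \<Otimes>\<^sub>M measure_pmf (unif_perm n)) borel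
              (\<lambda>(M, \<sigma>). sqrt (real n) *
                 mat_mult n (mat_mult n M (perm_mat n \<sigma>)) (mat_transpose n M) a b))
           (density lborel std_normal_density)"
proof (rule levy_continuity)
  define f where "f = (\<lambda>n (M, \<sigma>). sqrt (real n) *
                 mat_mult n (mat_mult n M (perm_mat n \<sigma>)) (mat_transpose n M) a b)"
  have haar: "haar n (\<mu> n)" for n
    by (rule haar.intro) (rule assms)
  have f_meas: "f n \<in> borel_measurable (\<mu> n \<Otimes>\<^sub>M measure_pmf (unif_perm n))" for n
    unfolding f_def by (rule haar.measurable_conj_perm[OF haar])
  show "real_distribution (distr (\<mu> n \<Otimes>\<^sub>M measure_pmf (unif_perm n)) borel
      (\<lambda>(M, \<sigma>). sqrt (real n) * mat_mult n (mat_mult n M (perm_mat n \<sigma>)) (mat_transpose n M) a b))" for n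
  proof -
    interpret haar n "\<mu> n" by (rule haar)
    interpret P: pair_prob_space "\<mu> n" "measure_pmf (unif_perm n)" by unfold_locales
    show ?thesis
      using f_meas[of n] unfolding f_def by (rule P.real_distribution_distr)
  qed
  show "real_distribution (density lborel std_normal_density)"
    by (rule real_dist_normal_dist)
  fix t :: real
  define C where "C = (1 + \<bar>t\<bar>) * exp (t\<^sup>2 / 2) * \<bar>t\<bar>"
  have "(\<lambda>n. char (distr (\<mu> n \<Otimes>\<^sub>M measure_pmf (unif_perm n)) borel (f n)) t
      - complex_of_real (exp (- (t\<^sup>2) / 2))) \<longlonglongrightarrow> 0"
  proof (rule Lim_null_comparison)
    show "\<forall>\<^sub>F n in sequentially. norm (char (distr (\<mu> n \<Otimes>\<^sub>M measure_pmf (unif_perm n)) borel (f n)) t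
        - complex_of_real (exp (- (t\<^sup>2) / 2))) \<le> 13 / sqrt n * C"
      \<comment> \<open>This threshold puts both indices below n, so that the entry is not the
        default value 0, and ensures n \<ge> 2 for the count of 2-cycles.\<close>
      using eventually_ge_at_top[of "a + b + 2"]
    proof eventually_elim
      case (elim n)
      then show ?case
        unfolding C_def
        by (intro haar.char_conj_uniform_perm[OF haar, of a _ b])
          (auto simp: f_meas, simp add: f_def mat_mult_perm_transpose)
    qed
    have "filterlim (\<lambda>n. sqrt (real n)) at_top sequentially"
      by (rule filterlim_compose[OF sqrt_at_top filterlim_real_sequentially])
    then have "(\<lambda>n. 13 / sqrt (real n)) \<longlonglongrightarrow> 0"
      by (intro tendsto_divide_0[OF tendsto_const] filterlim_at_top_imp_at_infinity)
    from tendsto_mult_left_zero[OF this] show "(\<lambda>n. 13 / sqrt (real n) * C) \<longlonglongrightarrow> 0" .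
  qed
  then show "(\<lambda>n. char (distr (\<mu> n \<Otimes>\<^sub>M measure_pmf (unif_perm n)) borel
      (\<lambda>(M, \<sigma>). sqrt (real n) * mat_mult n (mat_mult n M (perm_mat n \<sigma>)) (mat_transpose n M) a b)) t)
      \<longlonglongrightarrow> char (density lborel std_normal_density) t"
    unfolding char_std_normal_distribution f_def by (simp add: LIM_zero_iff)
qed

end
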